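(* Let $d\ge2$, $m\ge1$, and let $\mathcal{X}_1,\ldots,\mathcal{X}_m$ be any $m$ quantum channels on $\mathbb{C}^{d\times d}$ with $p(\mathcal{X}_i)=p$ and $u(\mathcal{X}_i)=u>0$ for all $i$, and let $\theta=\arccos(p/\sqrt u)$ be their common coherence angle. Then the effective depolarizing constant of the composite channel $\mathcal{X}_{1:m}=\mathcal{X}_1\cdots\mathcal{X}_m$ satisfies $$|p(\mathcal{X}_{1:m})-p^m|\leq \sqrt{\frac{d}{2}}\binom{m}{2}u\sin^2(\theta).$$ Furthermore, if the $\mathcal{X}_i$ are unital channels, the bound can be improved to $$|p(\mathcal{X}_{1:m})-p^m|\leq \binom{m}{2}u\sin^2(\theta).$$
   Context: A quantum channel on $\mathbb{C}^{d\times d}$ is a completely positive trace-preserving linear map $\mathcal{E}:\mathbb{C}^{d\times d}\to\mathbb{C}^{d\times d}$; it is unital if $\mathcal{E}(\mathbb{I}_d)=\mathbb{I}_d$. Products of channels denote composition: $\mathcal{A}\mathcal{B}(\rho)=\mathcal{A}[\mathcal{B}(\rho)]$. Fix a Hermitian trace-orthonormal basis $B_0=\mathbb{I}_d/\sqrt d,B_1,\ldots,B_{d^2-1}$ of $\mathbb{C}^{d\times d}$ ($\mathrm{Tr}\,B_j^\dagger B_k=\delta_{jk}$). The Liouville representation of $\mathcal{E}$ is the matrix with entries $\mathrm{Tr}(B_j^\dagger\mathcal{E}(B_k))$, $0\le j,k\le d^2-1$; it has block form $\begin{pmatrix}1&0\\ \boldsymbol{\mathcal{E}}_{\rm n}&\boldsymbol{\mathcal{E}}_{\rm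 u}\end{pmatrix}$, where the $(d^2-1)\times(d^2-1)$ matrix $\boldsymbol{\mathcal{E}}_{\rm u}$ is the unital block. The effective depolarizing constant and the unitarity are $$p(\mathcal{E})=\frac{\mathrm{Tr}\,\boldsymbol{\mathcal{E}}_{\rm u}}{d^2-1},\qquad u(\mathcal{E})=\frac{\mathrm{Tr}\,\boldsymbol{\mathcal{E}}_{\rm u}^\dagger\boldsymbol{\mathcal{E}}_{\rm u}}{d^2-1}=\frac{\|\boldsymbol{\mathcal{E}}_{\rm u}\|_F^2}{d^2-1}$$ (these do not depend on the choice of basis). The coherence angle is $\theta(\mathcal{E})=\arccos\big(p(\mathcal{E})/\sqrt{u(\mathcal{E})}\big)$. *)

theory Defs
  imports Complex_Main "Jordan_Normal_Form.Schur_Decomposition"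
begin

definition mat_trace :: "complex mat \<Rightarrow> complex" where
  "mat_trace A = (\<Sum>i<dim_row A. A $$ (i, i))"

text \<open>The order on complex numbers is that of \<^theory>\<open>HOL-Library.Complex_Order\<close>, so
  \<open>0 \<le> z\<close> says that \<open>z\<close> is real and nonnegative; Hermiticity is thereby implied.\<close>

definition psd_mat :: "nat \<Rightarrow> complex mat \<Rightarrow> bool" where
  "psd_mat n A \<longleftrightarrow> A \<in> carrier_mat n n \<and> (\<forall>v \<in> carrier_vec n. 0 \<le> (A *\<^sub>v v) \<bullet>c v)"

definition linear_mat_map :: "nat \<Rightarrow> (complex mat \<Rightarrow> complex mat) \<Rightarrow> bool" where
  "linear_mat_map d E \<longleftrightarrow>
     (\<forall>A \<in> carrier_mat d d. E A \<in> carrier_mat d d) \<and>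
     (\<forall>A \<in> carrier_mat d d. \<forall>B \<in> carrier_mat d d. E (A + B) = E A + E B) \<and>
     (\<forall>c. \<forall>A \<in> carrier_mat d d. E (c \<cdot>\<^sub>m A) = c \<cdot>\<^sub>m E A)"

text \<open>The map \<open>id\<^sub>k \<otimes> E\<close>: a \<open>kd \<times> kd\<close> matrix is read as a \<open>k \<times> k\<close> array of \<open>d \<times> d\<close> blocks,
  the block in position \<open>(a, b)\<close> having entries \<open>(a d + s, b d + t)\<close>, and \<open>E\<close> is applied to
  every block.\<close>

definition mat_block :: "nat \<Rightarrow> complex mat \<Rightarrow> nat \<Rightarrow> nat \<Rightarrow> complex mat" where
  "mat_block d M a b = mat d d (\<lambda>(s, t). M $$ (a * d + s, b * d + t))"

definition id_tensor :: "nat \<Rightarrow> nat \<Rightarrow> (complex mat \<Rightarrow> complex mat) \<Rightarrow> complex mat \<Rightarrow> complex mat" where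
  "id_tensor k d E M =
     mat (k * d) (k * d) (\<lambda>(i, j). E (mat_block d M (i div d) (j div d)) $$ (i mod d, j mod d))"

definition completely_positive :: "nat \<Rightarrow> (complex mat \<Rightarrow> complex mat) \<Rightarrow> bool" where
  "completely_positive d E \<longleftrightarrow>
     (\<forall>k M. psd_mat (k * d) M \<longrightarrow> psd_mat (k * d) (id_tensor k d E M))"

definition trace_preserving :: "nat \<Rightarrow> (complex mat \<Rightarrow> complex mat) \<Rightarrow> bool" where
  "trace_preserving d E \<longleftrightarrow> (\<forall>A \<in> carrier_mat d d. mat_trace (E A) = mat_trace A)"

definition quantum_channel :: "nat \<Rightarrow> (complex mat \<Rightarrow> complex mat) \<Rightarrow> bool" where
  "quantum_channel d E \<longleftrightarrow>
     linear_mat_map d E \<and> completely_positive d E \<and> trace_preserving d E"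

definition unital_map :: "nat \<Rightarrow> (complex mat \<Rightarrow> complex mat) \<Rightarrow> bool" where
  "unital_map d E \<longleftrightarrow> E (1\<^sub>m d) = 1\<^sub>m d"

text \<open>The basis elements are \<open>B 0, \<dots>, B (d\<^sup>2 - 1)\<close>; linear independence follows from
  trace-orthonormality.\<close>

definition hermitian_onb :: "nat \<Rightarrow> (nat \<Rightarrow> complex mat) \<Rightarrow> bool" where
  "hermitian_onb d B \<longleftrightarrow>
     (\<forall>j < d^2. B j \<in> carrier_mat d d \<and> mat_adjoint (B j) = B j) \<and>
     B 0 = complex_of_real (1 / sqrt (real d)) \<cdot>\<^sub>m 1\<^sub>m d \<and>
     (\<forall>j < d^2. \<forall>k < d^2. mat_trace (mat_adjoint (B j) * B k) = (if j = k then 1 else 0)) \<and>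
     (\<forall>A \<in> carrier_mat d d. \<exists>c :: nat \<Rightarrow> complex.
        \<forall>s < d. \<forall>t < d. A $$ (s, t) = (\<Sum>j < d^2. c j * B j $$ (s, t)))"

definition liouville :: "nat \<Rightarrow> (nat \<Rightarrow> complex mat) \<Rightarrow> (complex mat \<Rightarrow> complex mat) \<Rightarrow> complex mat" where
  "liouville d B E = mat (d^2) (d^2) (\<lambda>(j, k). mat_trace (mat_adjoint (B j) * E (B k)))"

definition unital_block :: "nat \<Rightarrow> (nat \<Rightarrow> complex mat) \<Rightarrow> (complex mat \<Rightarrow> complex mat) \<Rightarrow> complex mat" where
  "unital_block d B E = mat (d^2 - 1) (d^2 - 1) (\<lambda>(j, k). liouville d B E $$ (Suc j, Suc k))"

text \<open>Both traces below are real, the first one because a channel preserves Hermiticity and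
  the basis is Hermitian; \<^const>\<open>Re\<close> only converts the type.\<close>

definition depol_const :: "nat \<Rightarrow> (nat \<Rightarrow> complex mat) \<Rightarrow> (complex mat \<Rightarrow> complex mat) \<Rightarrow> real" where
  "depol_const d B E = Re (mat_trace (unital_block d B E)) / real (d^2 - 1)"

definition unitarity :: "nat \<Rightarrow> (nat \<Rightarrow> complex mat) \<Rightarrow> (complex mat \<Rightarrow> complex mat) \<Rightarrow> real" where
  "unitarity d B E =
     Re (mat_trace (mat_adjoint (unital_block d B E) * unital_block d B E)) / real (d^2 - 1)"

definition coherence_angle :: "nat \<Rightarrow> (nat \<Rightarrow> complex mat) \<Rightarrow> (complex mat \<Rightarrow> complex mat) \<Rightarrow> real" where
  "coherence_angle d B E = arccos (depol_const d B E / sqrt (unitarity d B E))"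

text \<open>\<open>X 1 \<circ> \<dots> \<circ> X m\<close>, so \<open>X m\<close> acts first.\<close>

definition composite :: "(nat \<Rightarrow> complex mat \<Rightarrow> complex mat) \<Rightarrow> nat \<Rightarrow> complex mat \<Rightarrow> complex mat" where
  "composite X m = foldr (\<circ>) (map X [1..<Suc m]) id"

end

(* Write the real unital block of X_i as p I + D_i with D_i traceless and
   |D_i|_F^2 <= s := (d^2 - 1)(u - p^2), and let P_k be the unital block of X_1 ... X_k. Then
   Tr P_(k+1) = p Tr P_k + Tr(P_k D_(k+1)), and for traceless D with |D|_F^2 <= s the identity
   Tr(P_k D) = p Tr(P_(k-1) D) + Tr(P_(k-1) D_k D), |p| <= 1 and Cauchy-Schwarz give
   |Tr(P_k D)| <= k c s whenever all prefixes have operator norm at most c. Summing over k produces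
   the binomial coefficient.

   For the operator norm let H = sum_j l_j |w_j><w_j| be Hermitian and traceless and put
   G_jk = Tr(E(|w_j><w_j|) E(|w_k><w_k|)), so that Tr E(H)^2 = sum_jk l_j l_k G_jk with
   0 <= G_jk <= 1. Since sum_j l_j = 0, this is at most (sum_j |l_j|)^2 / 2 <= (d/2) Tr H^2. If E is
   unital then G is doubly stochastic, and the bound becomes Tr H^2.

   Finally |p| <= 1 holds because 1 + (d^2 - 1) p is the sum of all entries of a psd d x d principal
   submatrix of the Choi matrix whose diagonal entries are at most 1. *)

theory Submission
  imports Defs "HOL-Analysis.L2_Norm" "Jordan_Normal_Form.Spectral_Radius"
begin

section \<open>Traces of products of real matrices\<close>

text \<open>Cauchy-Schwarz for vectors of norm at most \<open>a * sqrt s\<close> and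
  \<open>sqrt s\<close>; the two roots multiply to a bound without roots.\<close>

lemma abs_sum_mult_le_of_sum_squares:
  fixes f g :: "'a \<Rightarrow> real"
  assumes "(\<Sum>x\<in>S. (f x)\<^sup>2) \<le> a\<^sup>2 * s" and "(\<Sum>x\<in>S. (g x)\<^sup>2) \<le> s" and "0 \<le> a"
  shows "\<bar>\<Sum>x\<in>S. f x * g x\<bar> \<le> a * s"
proof -
  have s: "0 \<le> s" using assms(2) by (meson order_trans sum_nonneg zero_le_power2)
  have "\<bar>\<Sum>x\<in>S. f x * g x\<bar> \<le> (\<Sum>x\<in>S. \<bar>f x\<bar> * \<bar>g x\<bar>)"
    by (rule order_trans[OF sum_abs]) (simp add: abs_mult)
  also have "\<dots> \<le> L2_set f S * L2_set g S" by (rule L2_set_mult_ineq)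
  also have "\<dots> \<le> sqrt (a\<^sup>2 * s) * sqrt s"
    unfolding L2_set_def using assms by (intro mult_mono real_sqrt_le_mono) (auto simp: s sum_nonneg)
  also have "\<dots> = a * s" using s assms(3) by (simp add: real_sqrt_mult)
  finally show ?thesis .
qed

text \<open>The part of the argument that concerns real matrices only. The norm bound
  \<open>contr\<close> is imposed on whole prefixes \<open>P k\<close> and not on single factors, so
  that \<open>c\<close> enters the estimate once and not as a power.\<close>

lemma trace_product_deviation:
  fixes P M :: "nat \<Rightarrow> nat \<Rightarrow> nat \<Rightarrow> real" and n N :: nat and c p u :: real
  assumes P_0: "\<And>i j. i < n \<Longrightarrow> j < n \<Longrightarrow> P 0 i j = (if i = j then 1 else 0)"
    and P_Suc: "\<And>k i j. k < N \<Longrightarrow> i < n \<Longrightarrow> j < n \<Longrightarrow> P (Suc k) i j = (\<Sum>l<n. P k i l * M k l j)"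
    and contr: "\<And>k v. k < N \<Longrightarrow> (\<Sum>i<n. (\<Sum>j<n. P k i j * v j)\<^sup>2) \<le> c\<^sup>2 * (\<Sum>i<n. (v i)\<^sup>2)"
    and c: "0 \<le> c" and p: "\<bar>p\<bar> \<le> 1"
    and tr: "\<And>k. k < N \<Longrightarrow> (\<Sum>i<n. M k i i) = real n * p"
    and frob: "\<And>k. k < N \<Longrightarrow> (\<Sum>i<n. \<Sum>j<n. (M k i j)\<^sup>2) \<le> real n * u"
  shows "\<bar>(\<Sum>i<n. P N i i) - real n * p ^ N\<bar> \<le> c * real (N choose 2) * (real n * (u - p\<^sup>2))"
proof -
  define s where "s = real n * (u - p\<^sup>2)"
  define D where "D k i j = M k i j - (if i = j then p else 0)" for k i j
  have D_tr: "(\<Sum>i<n. D k i i) = 0" if "k < N" for k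
    using tr[OF that] by (simp add: D_def sum_subtractf)
  \<comment> \<open>Removing the multiple of the identity is an orthogonal projection: the squared
    norm drops by exactly \<open>n * p^2\<close>.\<close>
  have D_frob: "(\<Sum>i<n. \<Sum>j<n. (D k i j)\<^sup>2) \<le> s" if "k < N" for k
  proof -
    have "(\<Sum>j<n. (D k i j)\<^sup>2) = (\<Sum>j<n. (M k i j)\<^sup>2) - 2 * p * M k i i + p\<^sup>2" if "i < n" for i
    proof -
      have "(D k i j)\<^sup>2 = (M k i j)\<^sup>2 + (if i = j then p\<^sup>2 - 2 * p * M k i j else 0)" for j
        by (simp add: D_def power2_eq_square algebra_simps)
      then show ?thesis using that by (simp add: sum.distrib)
    qed
    then have "(\<Sum>i<n. \<Sum>j<n. (D k i j)\<^sup>2)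
        = (\<Sum>i<n. \<Sum>j<n. (M k i j)\<^sup>2) - 2 * p * (\<Sum>i<n. M k i i) + real n * p\<^sup>2"
      by (simp add: sum.distrib sum_subtractf sum_distrib_left)
    also have "\<dots> \<le> s"
      using frob[OF that] by (simp add: tr[OF that] s_def power2_eq_square algebra_simps)
    finally show ?thesis .
  qed
  have split: "P (Suc k) i l = p * P k i l + (\<Sum>j<n. P k i j * D k j l)"
    if "k < N" "i < n" "l < n" for k i l
  proof -
    have "P (Suc k) i l = (\<Sum>j<n. P k i j * D k j l + (if j = l then p * P k i l else 0))"
      unfolding P_Suc[OF that] by (rule sum.cong) (auto simp: D_def algebra_simps)
    then show ?thesis using that by (simp add: sum.distrib)
  qed
  \<comment> \<open>\<open>F\<close> is not tied to \<open>k\<close>: the trace of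
    \<open>P k\<close> against \<open>D k\<close> unfolds into traces of shorter prefixes against
    that same \<open>D k\<close>.\<close>
  have traceless: "\<bar>\<Sum>i<n. \<Sum>l<n. P k i l * F l i\<bar> \<le> real k * (c * s)"
    if "k \<le> N" "(\<Sum>i<n. F i i) = 0" "(\<Sum>i<n. \<Sum>j<n. (F i j)\<^sup>2) \<le> s" for k F
    using that(1)
  proof (induction k)
    case 0
    have "(\<Sum>l<n. P 0 i l * F l i) = F i i" if "i < n" for i
    proof -
      have "(\<Sum>l<n. P 0 i l * F l i) = (\<Sum>l<n. if i = l then F i i else 0)"
        by (rule sum.cong) (auto simp: P_0 that)
      then show ?thesis using that by simp
    qed
    then show ?case using that(2) by simp
  next
    case (Suc k)
    define Q where "Q i l = (\<Sum>j<n. P k i j * D k j l)" for i l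
    have k: "k < N" using Suc.prems by simp
    have IH: "\<bar>\<Sum>i<n. \<Sum>l<n. P k i l * F l i\<bar> \<le> real k * (c * s)"
      using Suc.IH k by (simp only: less_imp_le)
    \<comment> \<open>Column-wise summation lets \<open>contr\<close> act on each column of
      \<open>D k\<close>, so left multiplication by \<open>P k\<close> scales the Frobenius norm by
      at most \<open>c\<close>.\<close>
    have "(\<Sum>i<n. \<Sum>l<n. (Q i l)\<^sup>2) = (\<Sum>l<n. \<Sum>i<n. (Q i l)\<^sup>2)" by (rule sum.swap)
    also have "\<dots> \<le> (\<Sum>l<n. c\<^sup>2 * (\<Sum>j<n. (D k j l)\<^sup>2))"
      unfolding Q_def by (intro sum_mono contr k)
    also have "\<dots> = c\<^sup>2 * (\<Sum>j<n. \<Sum>l<n. (D k j l)\<^sup>2)"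
      by (subst sum.swap) (simp add: sum_distrib_left)
    also have "\<dots> \<le> c\<^sup>2 * s" using D_frob[OF k] by (intro mult_left_mono) auto
    finally have Q: "(\<Sum>i<n. \<Sum>l<n. (Q i l)\<^sup>2) \<le> c\<^sup>2 * s" .
    have F: "(\<Sum>i<n. \<Sum>l<n. (F l i)\<^sup>2) \<le> s" using that(3) by (subst sum.swap)
    have *: "\<bar>\<Sum>i<n. \<Sum>l<n. Q i l * F l i\<bar> \<le> c * s"
      using abs_sum_mult_le_of_sum_squares[of "\<lambda>(i,l). Q i l" "{..<n} \<times> {..<n}" c s "\<lambda>(i,l). F l i"] Q F c
      by (simp add: sum.cartesian_product case_prod_unfold)
    have "(\<Sum>i<n. \<Sum>l<n. P (Suc k) i l * F l i)
        = p * (\<Sum>i<n. \<Sum>l<n. P k i l * F l i) + (\<Sum>i<n. \<Sum>l<n. Q i l * F l i)"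
      by (simp add: split[OF k] Q_def[symmetric] sum_distrib_left sum.distrib distrib_right mult.assoc)
    then have "\<bar>\<Sum>i<n. \<Sum>l<n. P (Suc k) i l * F l i\<bar>
        \<le> \<bar>p\<bar> * \<bar>\<Sum>i<n. \<Sum>l<n. P k i l * F l i\<bar> + \<bar>\<Sum>i<n. \<Sum>l<n. Q i l * F l i\<bar>"
      by (simp only: abs_mult[symmetric] abs_triangle_ineq)
    also have "\<dots> \<le> 1 * (real k * (c * s)) + c * s"
      by (rule add_mono[OF mult_mono[OF p IH] *]) simp_all
    also have "\<dots> = real (Suc k) * (c * s)" by (simp only: of_nat_Suc distrib_right)
    finally show ?case .
  qed
  have "\<bar>(\<Sum>i<n. P k i i) - real n * p ^ k\<bar> \<le> c * real (k choose 2) * s" if "k \<le> N" for k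
    using that
  proof (induction k)
    case 0
    then show ?case by (simp add: P_0 binomial_eq_0)
  next
    case (Suc k)
    then have k: "k < N" by simp
    have IH: "\<bar>(\<Sum>i<n. P k i i) - real n * p ^ k\<bar> \<le> c * real (k choose 2) * s"
      using Suc.IH k by (simp only: less_imp_le)
    have "(\<Sum>i<n. P (Suc k) i i) = p * (\<Sum>i<n. P k i i) + (\<Sum>i<n. \<Sum>l<n. P k i l * D k l i)"
      by (simp add: split[OF k] sum.distrib sum_distrib_left)
    then have "(\<Sum>i<n. P (Suc k) i i) - real n * p ^ Suc k
        = p * ((\<Sum>i<n. P k i i) - real n * p ^ k) + (\<Sum>i<n. \<Sum>l<n. P k i l * D k l i)"
      by (simp add: algebra_simps)
    then have "\<bar>(\<Sum>i<n. P (Suc k) i i) - real n * p ^ Suc k\<bar>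
        \<le> \<bar>p\<bar> * \<bar>(\<Sum>i<n. P k i i) - real n * p ^ k\<bar> + \<bar>\<Sum>i<n. \<Sum>l<n. P k i l * D k l i\<bar>"
      by (simp only: abs_mult[symmetric] abs_triangle_ineq)
    also have "\<dots> \<le> 1 * (c * real (k choose 2) * s) + real k * (c * s)"
      by (rule add_mono[OF mult_mono[OF p IH] traceless[OF less_imp_le[OF k] D_tr[OF k] D_frob[OF k]]]) simp_all
    \<comment> \<open>Pascal's rule: the increment \<open>k\<close> turns \<open>k choose 2\<close>
      into \<open>Suc k choose 2\<close>.\<close>
    also have "\<dots> = c * real (Suc k choose 2) * s"
      by (simp add: numeral_2_eq_2 distrib_left distrib_right)
    finally show ?case .
  qed
  then show ?thesis by (simp add: s_def)
qed

section \<open>Spectral decomposition of Hermitian matrices\<close>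

lemma index_mult_square:
  assumes "A \<in> carrier_mat n n" "C \<in> carrier_mat n n" "i < n" "j < n"
  shows "(A * C) $$ (i, j) = (\<Sum>k<n. A $$ (i, k) * C $$ (k, j))"
  using assms by (simp add: scalar_prod_def atLeast0LessThan)

lemma mat_adjoint_carrier: "A \<in> carrier_mat n n \<Longrightarrow> mat_adjoint A \<in> carrier_mat n n"
  by (auto simp: mat_adjoint_def mat_of_rows_def)

lemma index_mat_adjoint:
  fixes A :: "complex mat"
  shows "A \<in> carrier_mat n n \<Longrightarrow> i < n \<Longrightarrow> j < n \<Longrightarrow> mat_adjoint A $$ (i, j) = cnj (A $$ (j, i))"
  by (simp add: mat_adjoint_def mat_of_rows_def)

text \<open>An eigenvector is completed to a basis and orthogonalised. Gram-Schmidt leaves the first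
  vector fixed, so column 0 is still an eigenvector after each vector is divided by its length
  \<open>r i\<close>.\<close>

lemma unitary_with_eigenvector_column:
  fixes A :: "complex mat"
  assumes A: "A \<in> carrier_mat n n" and n: "n > 0"
  obtains U e where "U \<in> carrier_mat n n" "mat_adjoint U * U = 1\<^sub>m n"
    "A *\<^sub>v col U 0 = e \<cdot>\<^sub>v col U 0"
proof -
  obtain e where "eigenvalue A e"
    using spectrum_non_empty[OF A n] by (auto simp: spectrum_def)
  then obtain v where v: "v \<in> carrier_vec n" "v \<noteq> 0\<^sub>v n" "A *\<^sub>v v = e \<cdot>\<^sub>v v"
    using A by (auto simp: eigenvalue_def eigenvector_def)
  interpret cof_vec_space n "TYPE(complex)" .
  define b where "b = basis_completion v"
  define ws where "ws = gram_schmidt n b"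
  note bc = basis_completion[OF v(1,2), folded b_def]
  note gs = gram_schmidt_result[OF bc(2,4,5) ws_def]
  have len: "length ws = n" using gs(4) bc(6) by simp
  obtain b' where b': "b = v # b'" using bc(6,7) n by (cases b) auto
  have hd: "ws ! 0 = v"
    using gram_schmidt_hd[OF v(1), of b'] len n unfolding b'[symmetric] ws_def[symmetric]
    by (cases ws) auto
  have ws: "ws ! i \<in> carrier_vec n" if "i < n" for i
    using gs(3) len that by (auto simp: subset_iff)
  define r where "r i = sqrt (\<Sum>s<n. (cmod (ws ! i $ s))\<^sup>2)" for i
  have ip: "ws ! i \<bullet>c ws ! j = (\<Sum>s<n. ws ! i $ s * cnj (ws ! j $ s))" if "i < n" "j < n" for i j
    using ws[OF that(1)] ws[OF that(2)] by (simp add: scalar_prod_def atLeast0LessThan)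
  have ip_self: "ws ! i \<bullet>c ws ! i = complex_of_real ((r i)\<^sup>2)" if "i < n" for i
    unfolding ip[OF that that] r_def complex_norm_square[symmetric] of_real_sum[symmetric]
    by (simp only: real_sqrt_pow2 sum_nonneg zero_le_power2)
  have orth: "(ws ! i \<bullet>c ws ! j = 0) = (i \<noteq> j)" if "i < n" "j < n" for i j
    using gs(2) len that by (auto simp: corthogonal_def)
  have r: "r i \<noteq> 0" if "i < n" for i
    using orth[OF that that] ip_self[OF that] by auto
  define U where "U = mat n n (\<lambda>(s, i). ws ! i $ s / complex_of_real (r i))"
  have U: "U \<in> carrier_mat n n" by (simp add: U_def)
  have "mat_adjoint U * U = 1\<^sub>m n"
  proof (rule eq_matI)
    fix i j assume "i < dim_row (1\<^sub>m n :: complex mat)" "j < dim_col (1\<^sub>m n :: complex mat)"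
    then have ij: "i < n" "j < n" by auto
    have "(mat_adjoint U * U) $$ (i, j)
        = (\<Sum>s<n. ws ! j $ s * cnj (ws ! i $ s)) / (complex_of_real (r i) * complex_of_real (r j))"
      using U ij by (simp add: index_mult_square[OF mat_adjoint_carrier[OF U] U] index_mat_adjoint[OF U]
          sum_divide_distrib) (simp add: U_def mult.commute)
    also have "\<dots> = (if i = j then 1 else 0)"
      unfolding ip[OF ij(2,1), symmetric]
      using orth[OF ij(2,1)] ip_self[OF ij(1)] r[OF ij(1)] by (auto simp: power2_eq_square)
    finally show "(mat_adjoint U * U) $$ (i, j) = (1\<^sub>m n) $$ (i, j)" using ij by simp
  qed (use U mat_adjoint_carrier[OF U] in auto)
  moreover have "col U 0 = (1 / complex_of_real (r 0)) \<cdot>\<^sub>v v"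
    using n v(1) by (auto simp: U_def hd)
  then have "A *\<^sub>v col U 0 = e \<cdot>\<^sub>v col U 0"
    using A v by (simp add: mult_mat_vec smult_smult_assoc mult.commute)
  ultimately show thesis using that U by blast
qed

text \<open>\<open>w k\<close> is the k-th eigenvector as a coordinate function and
  \<open>l k\<close> its eigenvalue. Sums over coordinates replace matrix products, which keeps
  later exchanges of summation elementary.\<close>

definition spectral_decomp :: "nat \<Rightarrow> complex mat \<Rightarrow> (nat \<Rightarrow> nat \<Rightarrow> complex) \<Rightarrow> (nat \<Rightarrow> real) \<Rightarrow> bool" where
  "spectral_decomp n A w l \<longleftrightarrow>
     (\<forall>s<n. \<forall>t<n. A $$ (s, t) = (\<Sum>k<n. of_real (l k) * (w k s * cnj (w k t)))) \<and>
     (\<forall>j<n. \<forall>k<n. (\<Sum>s<n. cnj (w j s) * w k s) = (if j = k then 1 else 0))"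

text \<open>The third fact is the completeness relation: for the square matrix with columns
  \<open>w k\<close>, the left inverse given by orthonormality is also a right inverse.\<close>

lemma spectral_decompD:
  assumes "spectral_decomp n A w l"
  shows "\<And>s t. s < n \<Longrightarrow> t < n \<Longrightarrow> A $$ (s, t) = (\<Sum>k<n. of_real (l k) * (w k s * cnj (w k t)))"
    and "\<And>j k. j < n \<Longrightarrow> k < n \<Longrightarrow> (\<Sum>s<n. cnj (w j s) * w k s) = (if j = k then 1 else 0)"
    and "\<And>s t. s < n \<Longrightarrow> t < n \<Longrightarrow> (\<Sum>k<n. w k s * cnj (w k t)) = (if s = t then 1 else 0)"
proof -
  show *: "\<And>s t. s < n \<Longrightarrow> t < n \<Longrightarrow> A $$ (s, t) = (\<Sum>k<n. of_real (l k) * (w k s * cnj (w k t)))"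
    "\<And>j k. j < n \<Longrightarrow> k < n \<Longrightarrow> (\<Sum>s<n. cnj (w j s) * w k s) = (if j = k then 1 else 0)"
    using assms by (auto simp: spectral_decomp_def)
  define U where "U = mat n n (\<lambda>(s, k). w k s)"
  have U: "U \<in> carrier_mat n n" by (simp add: U_def)
  have "mat_adjoint U * U = 1\<^sub>m n"
  proof (rule eq_matI)
    fix i j assume "i < dim_row (1\<^sub>m n :: complex mat)" "j < dim_col (1\<^sub>m n :: complex mat)"
    then show "(mat_adjoint U * U) $$ (i, j) = (1\<^sub>m n) $$ (i, j)"
      using *(2)[of i j] by (simp add: index_mult_square[OF mat_adjoint_carrier[OF U] U] index_mat_adjoint[OF U])
        (cases "i = j"; simp add: U_def)
  qed (use U mat_adjoint_carrier[OF U] in auto)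
  then have 1: "U * mat_adjoint U = 1\<^sub>m n"
    using mat_mult_left_right_inverse mat_adjoint_carrier[OF U] U by blast
  show "(\<Sum>k<n. w k s * cnj (w k t)) = (if s = t then 1 else 0)" if "s < n" "t < n" for s t
    using that arg_cong[OF 1, of "\<lambda>M. M $$ (s, t)"]
    by (simp add: index_mult_square[OF U mat_adjoint_carrier[OF U]] index_mat_adjoint[OF U])
      (cases "s = t"; simp add: U_def)
qed

text \<open>Induction on the dimension. In a unitary basis that starts with an eigenvector, the
  first column vanishes off the diagonal, Hermiticity clears the first row as well, and the
  hypothesis applies to the remaining block \<open>C\<close>.\<close>

lemma hermitian_spectral_decomp:
  assumes "A \<in> carrier_mat n n" "\<And>s t. s < n \<Longrightarrow> t < n \<Longrightarrow> A $$ (t, s) = cnj (A $$ (s, t))"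
  shows "\<exists>w l. spectral_decomp n A w l"
  using assms
proof (induction n arbitrary: A)
  case 0
  then show ?case by (simp add: spectral_decomp_def)
next
  case (Suc m)
  let ?n = "Suc m"
  note A = Suc.prems(1)
  obtain U e where U: "U \<in> carrier_mat ?n ?n" and VU: "mat_adjoint U * U = 1\<^sub>m ?n"
    and eig: "A *\<^sub>v col U 0 = e \<cdot>\<^sub>v col U 0"
    using unitary_with_eigenvector_column[OF A] by blast
  let ?V = "mat_adjoint U"
  have V: "?V \<in> carrier_mat ?n ?n" by (rule mat_adjoint_carrier[OF U])
  have UV: "U * ?V = 1\<^sub>m ?n" by (rule mat_mult_left_right_inverse[OF V U VU])
  define A' where "A' = ?V * (A * U)"
  have A': "A' \<in> carrier_mat ?n ?n" using A U V by (simp add: A'_def)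
  have "U * A' * ?V = (U * ?V) * A * (U * ?V)"
    unfolding A'_def using A U V by (simp add: assoc_mult_mat[of _ ?n ?n _ ?n _ ?n])
  then have A_eq: "A = U * A' * ?V" using A by (simp add: UV)
  have U_ip: "(\<Sum>s<?n. cnj (U $$ (s, i)) * U $$ (s, j)) = (if i = j then 1 else 0)"
    if "i < ?n" "j < ?n" for i j
    using arg_cong[OF VU, of "\<lambda>M. M $$ (i, j)"] that
    by (simp add: index_mult_square[OF V U] index_mat_adjoint[OF U] del: sum.lessThan_Suc)
  have A'_eq: "A' $$ (i, j) = (\<Sum>s<?n. \<Sum>t<?n. cnj (U $$ (s, i)) * A $$ (s, t) * U $$ (t, j))"
    if "i < ?n" "j < ?n" for i j
    unfolding A'_def using A U V that
    by (simp add: index_mult_square[OF V] index_mult_square[OF A U] index_mat_adjoint[OF U]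
        sum_distrib_left mult.assoc del: sum.lessThan_Suc index_mult_mat(1))
  have A'_herm: "A' $$ (j, i) = cnj (A' $$ (i, j))" if "i < ?n" "j < ?n" for i j
  proof -
    have "cnj (A' $$ (i, j)) = (\<Sum>s<?n. \<Sum>t<?n. cnj (U $$ (t, j)) * A $$ (t, s) * U $$ (s, i))"
      unfolding A'_eq[OF that] cnj_sum
      by (intro sum.cong refl) (simp add: Suc.prems(2)[symmetric] mult_ac)
    also have "\<dots> = A' $$ (j, i)" unfolding A'_eq[OF that(2,1)] by (rule sum.swap)
    finally show ?thesis by simp
  qed
  have A'_col: "A' $$ (i, 0) = (if i = 0 then e else 0)" if "i < ?n" for i
  proof -
    have AU: "(\<Sum>t<?n. A $$ (s, t) * U $$ (t, 0)) = e * U $$ (s, 0)" if "s < ?n" for s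
      using arg_cong[OF eig, of "\<lambda>v. v $ s"] that A U
      by (simp add: scalar_prod_def atLeast0LessThan del: sum.lessThan_Suc)
    have "A' $$ (i, 0) = (\<Sum>s<?n. cnj (U $$ (s, i)) * (\<Sum>t<?n. A $$ (s, t) * U $$ (t, 0)))"
      using that by (simp add: A'_eq sum_distrib_left mult.assoc del: sum.lessThan_Suc)
    also have "\<dots> = e * (\<Sum>s<?n. cnj (U $$ (s, i)) * U $$ (s, 0))"
      by (simp add: AU sum_distrib_left mult_ac del: sum.lessThan_Suc)
    also have "\<dots> = (if i = 0 then e else 0)" by (subst U_ip) (use that in auto)
    finally show ?thesis .
  qed
  have A'_row: "A' $$ (0, i) = (if i = 0 then e else 0)" if "i < ?n" for i
    using A'_herm[of i 0] A'_herm[of 0 0] A'_col[OF that] A'_col[of 0] that by auto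
  have e: "e = of_real (Re e)"
    using A'_herm[of 0 0] A'_col[of 0] by (simp add: complex_eq_iff)
  define C where "C = mat m m (\<lambda>(i, j). A' $$ (Suc i, Suc j))"
  have "\<exists>w l. spectral_decomp m C w l"
    by (rule Suc.IH) (auto simp: C_def intro: A'_herm)
  then obtain w l where wl: "spectral_decomp m C w l" by blast
  \<comment> \<open>The eigenvectors of \<open>C\<close>, padded by a leading zero and mapped back
    by \<open>U\<close>, follow the eigenvector in column 0.\<close>
  define w' where "w' k s = (case k of 0 \<Rightarrow> U $$ (s, 0) | Suc k \<Rightarrow> \<Sum>i<m. U $$ (s, Suc i) * w k i)" for k s
  define l' where "l' k = (case k of 0 \<Rightarrow> Re e | Suc k \<Rightarrow> l k)" for k
  have "A $$ (s, t) = (\<Sum>k<?n. of_real (l' k) * (w' k s * cnj (w' k t)))" if st: "s < ?n" "t < ?n" for s t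
  proof -
    have "A $$ (s, t) = (\<Sum>i<?n. \<Sum>j<?n. U $$ (s, i) * A' $$ (i, j) * cnj (U $$ (t, j)))"
    proof -
      have UA': "U * A' \<in> carrier_mat ?n ?n" using U A' by simp
      have "A $$ (s, t) = (\<Sum>j<?n. (U * A') $$ (s, j) * ?V $$ (j, t))"
        by (subst A_eq) (simp add: index_mult_square[OF UA' V] st del: sum.lessThan_Suc)
      also have "\<dots> = (\<Sum>j<?n. \<Sum>i<?n. U $$ (s, i) * A' $$ (i, j) * cnj (U $$ (t, j)))"
        using st by (simp add: index_mult_square[OF U A'] index_mat_adjoint[OF U] sum_distrib_right
            del: sum.lessThan_Suc)
      finally show ?thesis by (subst sum.swap)
    qed
    also have "\<dots> = U $$ (s, 0) * e * cnj (U $$ (t, 0))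
        + (\<Sum>i<m. \<Sum>j<m. U $$ (s, Suc i) * C $$ (i, j) * cnj (U $$ (t, Suc j)))"
      by (simp add: sum.lessThan_Suc_shift A'_row A'_col C_def del: sum.lessThan_Suc)
    also have "(\<Sum>i<m. \<Sum>j<m. U $$ (s, Suc i) * C $$ (i, j) * cnj (U $$ (t, Suc j)))
        = (\<Sum>i<m. \<Sum>j<m. \<Sum>k<m. of_real (l k) * ((U $$ (s, Suc i) * w k i) * cnj (U $$ (t, Suc j) * w k j)))"
      by (intro sum.cong)
        (simp_all add: spectral_decompD(1)[OF wl] sum_distrib_left sum_distrib_right mult_ac)
    also have "\<dots> = (\<Sum>k<m. \<Sum>i<m. \<Sum>j<m. of_real (l k) * ((U $$ (s, Suc i) * w k i) * cnj (U $$ (t, Suc j) * w k j)))"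
      by (subst (2) sum.swap, subst sum.swap, rule refl)
    also have "\<dots> = (\<Sum>k<m. of_real (l k) * (w' (Suc k) s * cnj (w' (Suc k) t)))"
      unfolding w'_def nat.case cnj_sum sum_product by (simp only: sum_distrib_left)
    also have "U $$ (s, 0) * e * cnj (U $$ (t, 0)) = of_real (l' 0) * (w' 0 s * cnj (w' 0 t))"
      by (subst e) (simp add: w'_def l'_def)
    finally show ?thesis
      by (simp add: sum.lessThan_Suc_shift l'_def del: sum.lessThan_Suc)
  qed
  moreover have "(\<Sum>s<?n. cnj (w' j s) * w' k s) = (if j = k then 1 else 0)" if "j < ?n" "k < ?n" for j k
  proof -
    \<comment> \<open>\<open>f k\<close> holds the coordinates of \<open>w' k\<close> in the columns
      of \<open>U\<close>. As \<open>U\<close> preserves inner products, orthonormality need only be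
      checked for these coordinates.\<close>
    define f where "f k i = (case k of 0 \<Rightarrow> (if i = 0 then 1 else 0)
        | Suc k \<Rightarrow> (case i of 0 \<Rightarrow> 0 | Suc i \<Rightarrow> w k i))" for k i :: nat
    have w': "w' k s = (\<Sum>i<?n. U $$ (s, i) * f k i)" for k s
      by (cases k) (simp_all add: w'_def f_def sum.lessThan_Suc_shift del: sum.lessThan_Suc)
    have "(\<Sum>s<?n. cnj (w' j s) * w' k s)
        = (\<Sum>s<?n. \<Sum>a<?n. \<Sum>b<?n. cnj (f j a) * f k b * (cnj (U $$ (s, a)) * U $$ (s, b)))"
      unfolding w' cnj_sum sum_product by (intro sum.cong) (simp_all add: mult_ac)
    also have "\<dots> = (\<Sum>a<?n. \<Sum>b<?n. cnj (f j a) * f k b * (\<Sum>s<?n. cnj (U $$ (s, a)) * U $$ (s, b)))"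
      unfolding sum_distrib_left by (subst sum.swap, subst (2) sum.swap, rule refl)
    also have "\<dots> = (\<Sum>a<?n. \<Sum>b<?n. if a = b then cnj (f j a) * f k a else 0)"
      by (intro sum.cong refl) (simp add: U_ip del: sum.lessThan_Suc)
    also have "\<dots> = (\<Sum>a<?n. cnj (f j a) * f k a)"
      by (intro sum.cong refl) (simp del: sum.lessThan_Suc)
    also have "\<dots> = (if j = k then 1 else 0)"
      using that by (cases j; cases k)
        (simp_all add: f_def sum.lessThan_Suc_shift spectral_decompD(2)[OF wl] del: sum.lessThan_Suc)
    finally show ?thesis .
  qed
  ultimately show ?case unfolding spectral_decomp_def by blast
qed

section \<open>Positive semidefinite matrices and positive maps\<close>

lemma mat_trace_mult:
  assumes "A \<in> carrier_mat n n" "C \<in> carrier_mat n n"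
  shows "mat_trace (A * C) = (\<Sum>s<n. \<Sum>t<n. A $$ (s, t) * C $$ (t, s))"
  using assms by (simp add: mat_trace_def index_mult_square[OF assms] del: index_mult_mat(1))

lemma psd_mat_iff:
  "psd_mat n A \<longleftrightarrow> A \<in> carrier_mat n n \<and>
     (\<forall>x. 0 \<le> (\<Sum>s<n. \<Sum>t<n. cnj (x s) * A $$ (s, t) * x t))"
proof -
  have *: "(A *\<^sub>v v) \<bullet>c v = (\<Sum>s<n. \<Sum>t<n. cnj (v $ s) * A $$ (s, t) * v $ t)"
    if "A \<in> carrier_mat n n" "v \<in> carrier_vec n" for v
    using that by (simp add: scalar_prod_def atLeast0LessThan sum_distrib_left sum_distrib_right mult_ac)
  have "0 \<le> (\<Sum>s<n. \<Sum>t<n. cnj (x s) * A $$ (s, t) * x t)"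
    if "psd_mat n A" for x
  proof -
    have "0 \<le> (A *\<^sub>v vec n x) \<bullet>c vec n x" using that by (simp add: psd_mat_def)
    then show ?thesis using that *[of "vec n x"] by (simp add: psd_mat_def)
  qed
  then show ?thesis using * by (auto simp: psd_mat_def)
qed

lemma psd_quadratic_form_nonneg:
  "psd_mat n A \<Longrightarrow> 0 \<le> (\<Sum>s<n. \<Sum>t<n. cnj (x s) * A $$ (s, t) * x t)"
  by (simp add: psd_mat_iff)

lemma psd_carrier: "psd_mat n A \<Longrightarrow> A \<in> carrier_mat n n"
  by (simp add: psd_mat_def)

text \<open>Polarisation: the quadratic form is real on vectors with at most two nonzero entries.
  The entries \<open>(1, 1)\<close> compare the imaginary parts of \<open>A $$ (s, t)\<close> and
  \<open>A $$ (t, s)\<close>, and \<open>(1, \<i>)\<close> the real parts.\<close>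

lemma psd_mat_hermitian:
  assumes "psd_mat n A" "s < n" "t < n"
  shows "A $$ (t, s) = cnj (A $$ (s, t))"
proof -
  have pt: "Im (cnj a * A $$ (i, i) * a + cnj a * A $$ (i, j) * b + cnj b * A $$ (j, i) * a
      + cnj b * A $$ (j, j) * b) = 0" if "i < n" "j < n" "i \<noteq> j" for i j a b
  proof -
    define x where "x k = (if k = i then a else if k = j then b else 0)" for k
    have *: "(\<Sum>k<n. f k) = f i + f j" if "\<And>k. k \<noteq> i \<Longrightarrow> k \<noteq> j \<Longrightarrow> f k = 0" for f :: "nat \<Rightarrow> complex"
    proof -
      have "(\<Sum>k<n. f k) = sum f {i, j}"
        using \<open>i < n\<close> \<open>j < n\<close> that by (intro sum.mono_neutral_right) auto
      then show ?thesis using \<open>i \<noteq> j\<close> by simp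
    qed
    have "(\<Sum>s<n. \<Sum>t<n. cnj (x s) * A $$ (s, t) * x t)
        = cnj a * A $$ (i, i) * a + cnj a * A $$ (i, j) * b + (cnj b * A $$ (j, i) * a
          + cnj b * A $$ (j, j) * b)"
      using \<open>i \<noteq> j\<close> by (subst *, simp add: x_def)+ (simp add: x_def)
    then show ?thesis
      using psd_quadratic_form_nonneg[OF assms(1), of x] by (simp add: less_eq_complex_def add.assoc)
  qed
  have diag: "Im (A $$ (i, i)) = 0" if "i < n" for i
  proof -
    have "(\<Sum>s<n. \<Sum>t<n. cnj (if s = i then 1 else 0) * A $$ (s, t) * (if t = i then 1 else 0)) = A $$ (i, i)"
      using that by (simp add: if_distrib[of "\<lambda>z. z * _"] if_distrib[of "\<lambda>z. _ * z"] if_distrib[of cnj] cong: if_cong)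
    then show ?thesis
      using psd_quadratic_form_nonneg[OF assms(1), of "\<lambda>k. if k = i then 1 else 0"]
      by (simp add: less_eq_complex_def)
  qed
  show ?thesis
  proof (cases "s = t")
    case True
    then show ?thesis using diag[OF assms(2)] by (simp add: complex_eq_iff)
  next
    case False
    have "Im (A $$ (s, t)) + Im (A $$ (t, s)) = 0" "Re (A $$ (s, t)) = Re (A $$ (t, s))"
      using pt[OF assms(2,3) False, of 1 1] pt[OF assms(2,3) False, of 1 \<i>]
        diag[OF assms(2)] diag[OF assms(3)] by auto
    then show ?thesis by (simp add: complex_eq_iff)
  qed
qed

section \<open>Rank-one matrices and traces of positive semidefinite products\<close>

definition rank_one :: "nat \<Rightarrow> (nat \<Rightarrow> complex) \<Rightarrow> complex mat" where
  "rank_one n x = mat n n (\<lambda>(s, t). x s * cnj (x t))"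

lemma rank_one_carrier [simp]: "rank_one n x \<in> carrier_mat n n"
  by (simp add: rank_one_def)

lemma psd_rank_one: "psd_mat n (rank_one n x)"
  unfolding psd_mat_iff
proof (intro conjI allI)
  fix y :: "nat \<Rightarrow> complex"
  define z where "z = (\<Sum>s<n. cnj (y s) * x s)"
  have "(\<Sum>s<n. \<Sum>t<n. cnj (y s) * rank_one n x $$ (s, t) * y t) = z * cnj z"
    unfolding z_def cnj_sum sum_product by (intro sum.cong refl) (simp add: rank_one_def mult_ac)
  also have "\<dots> = of_real ((cmod z)\<^sup>2)" by (rule complex_norm_square[symmetric])
  finally show "0 \<le> (\<Sum>s<n. \<Sum>t<n. cnj (y s) * rank_one n x $$ (s, t) * y t)"
    by (simp add: less_eq_complex_def)
qed simp

lemma mat_trace_rank_one: "mat_trace (rank_one n x) = (\<Sum>s<n. cnj (x s) * x s)"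
  by (simp add: mat_trace_def rank_one_def mult.commute)

text \<open>In an eigenbasis of \<open>Q\<close> the trace of \<open>P * Q\<close> is the sum of
  \<open>l k * q k\<close>, where all \<open>l k\<close> and \<open>q k\<close> are nonnegative and
  the \<open>q k\<close> add up to the trace of \<open>P\<close>. Replacing each \<open>q k\<close>
  by that total gives the upper bound.\<close>

lemma psd_trace_mult:
  assumes P: "psd_mat n P" and Q: "psd_mat n Q"
  shows "0 \<le> Re (mat_trace (P * Q))"
    and "Re (mat_trace (P * Q)) \<le> Re (mat_trace P) * Re (mat_trace Q)"
proof -
  obtain w l where wl: "spectral_decomp n Q w l"
    using hermitian_spectral_decomp[OF psd_carrier[OF Q] psd_mat_hermitian[OF Q]] by blast
  define q where "q k = (\<Sum>s<n. \<Sum>t<n. cnj (w k s) * P $$ (s, t) * w k t)" for k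
  have q: "0 \<le> Re (q k)" for k
    using psd_quadratic_form_nonneg[OF P, of "w k"] by (simp add: q_def less_eq_complex_def)
  \<comment> \<open>The quadratic form of \<open>Q\<close> at the eigenvector \<open>w k\<close> is
    the eigenvalue \<open>l k\<close>.\<close>
  have l: "0 \<le> l k" if "k < n" for k
  proof -
    have "(\<Sum>s<n. \<Sum>t<n. cnj (w k s) * Q $$ (s, t) * w k t)
        = (\<Sum>s<n. \<Sum>t<n. \<Sum>j<n. of_real (l j) * ((cnj (w k s) * w j s) * (cnj (w j t) * w k t)))"
      by (intro sum.cong refl) (simp add: spectral_decompD(1)[OF wl] sum_distrib_left sum_distrib_right mult_ac)
    also have "\<dots> = (\<Sum>j<n. \<Sum>s<n. \<Sum>t<n. of_real (l j) * ((cnj (w k s) * w j s) * (cnj (w j t) * w k t)))"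
      by (subst (2) sum.swap, subst sum.swap, rule refl)
    also have "\<dots> = (\<Sum>j<n. of_real (l j) * ((\<Sum>s<n. cnj (w k s) * w j s) * (\<Sum>t<n. cnj (w j t) * w k t)))"
      unfolding sum_product by (simp only: sum_distrib_left)
    also have "\<dots> = (\<Sum>j<n. if k = j then of_real (l j) else 0)"
      using that by (intro sum.cong refl) (simp add: spectral_decompD(2)[OF wl])
    also have "\<dots> = of_real (l k)" using that by simp
    finally show ?thesis
      using psd_quadratic_form_nonneg[OF Q, of "w k"] by (simp add: less_eq_complex_def)
  qed
  have "mat_trace (P * Q)
      = (\<Sum>s<n. \<Sum>t<n. \<Sum>k<n. of_real (l k) * (cnj (w k s) * P $$ (s, t) * w k t))"
    unfolding mat_trace_mult[OF psd_carrier[OF P] psd_carrier[OF Q]]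
    by (intro sum.cong refl) (simp add: spectral_decompD(1)[OF wl] sum_distrib_left mult_ac)
  also have "\<dots> = (\<Sum>k<n. \<Sum>s<n. \<Sum>t<n. of_real (l k) * (cnj (w k s) * P $$ (s, t) * w k t))"
    by (subst (2) sum.swap, subst sum.swap, rule refl)
  also have "\<dots> = (\<Sum>k<n. of_real (l k) * q k)"
    unfolding q_def sum_distrib_left ..
  finally have PQ: "Re (mat_trace (P * Q)) = (\<Sum>k<n. l k * Re (q k))" by simp
  have "mat_trace P = (\<Sum>s<n. \<Sum>t<n. if s = t then P $$ (s, t) else 0)"
    using psd_carrier[OF P] by (simp add: mat_trace_def)
  also have "\<dots> = (\<Sum>s<n. \<Sum>t<n. P $$ (s, t) * (\<Sum>k<n. w k t * cnj (w k s)))"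
    by (intro sum.cong refl) (simp add: spectral_decompD(3)[OF wl])
  also have "\<dots> = (\<Sum>s<n. \<Sum>t<n. \<Sum>k<n. cnj (w k s) * P $$ (s, t) * w k t)"
    by (simp add: sum_distrib_left mult_ac)
  also have "\<dots> = (\<Sum>k<n. q k)"
    unfolding q_def by (subst (2) sum.swap, subst sum.swap, rule refl)
  finally have trP: "Re (mat_trace P) = (\<Sum>k<n. Re (q k))" by simp
  have "mat_trace Q = (\<Sum>s<n. \<Sum>k<n. of_real (l k) * (cnj (w k s) * w k s))"
    using psd_carrier[OF Q] by (simp add: mat_trace_def spectral_decompD(1)[OF wl] mult_ac)
  also have "\<dots> = (\<Sum>k<n. of_real (l k) * (\<Sum>s<n. cnj (w k s) * w k s))"
    by (subst sum.swap) (simp add: sum_distrib_left)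
  also have "\<dots> = (\<Sum>k<n. of_real (l k))" by (simp add: spectral_decompD(2)[OF wl])
  finally have trQ: "Re (mat_trace Q) = (\<Sum>k<n. l k)" by simp
  show "0 \<le> Re (mat_trace (P * Q))" unfolding PQ by (intro sum_nonneg mult_nonneg_nonneg q l) simp
  have "(\<Sum>k<n. l k * Re (q k)) \<le> (\<Sum>k<n. l k * (\<Sum>j<n. Re (q j)))"
    by (intro sum_mono mult_left_mono member_le_sum l q) auto
  then show "Re (mat_trace (P * Q)) \<le> Re (mat_trace P) * Re (mat_trace Q)"
    unfolding PQ trP trQ by (simp add: sum_distrib_right mult.commute)
qed

text \<open>Linear combinations are given entry by entry, so no sum of matrices with its dimension
  conditions has to be handled.\<close>

lemma linear_mat_map_sum:
  assumes E: "linear_mat_map d E" and fin: "finite S"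
    and F: "\<And>k. k \<in> S \<Longrightarrow> F k \<in> carrier_mat d d" and M: "M \<in> carrier_mat d d"
    and eq: "\<And>s t. s < d \<Longrightarrow> t < d \<Longrightarrow> M $$ (s, t) = (\<Sum>k\<in>S. c k * F k $$ (s, t))"
    and st: "s < d" "t < d"
  shows "E M $$ (s, t) = (\<Sum>k\<in>S. c k * E (F k) $$ (s, t))"
  using fin F M eq
proof (induction S arbitrary: M)
  case empty
  \<comment> \<open>The empty combination is written as a scalar multiple so that homogeneity yields
    the value of \<open>E\<close> at zero.\<close>
  have "M = 0 \<cdot>\<^sub>m M" using empty by (intro eq_matI) auto
  then have "E M = 0 \<cdot>\<^sub>m E M" using E empty.prems(2) unfolding linear_mat_map_def by metis
  moreover have "E M \<in> carrier_mat d d" using E empty.prems(2) by (simp add: linear_mat_map_def)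
  ultimately have "E M $$ (s, t) = 0 * E M $$ (s, t)"
    using st by (metis carrier_matD index_smult_mat(1))
  then show ?case by simp
next
  case (insert x S)
  define M' where "M' = mat d d (\<lambda>(s, t). \<Sum>k\<in>S. c k * F k $$ (s, t))"
  have Fx: "F x \<in> carrier_mat d d" using insert.prems(1) by simp
  have M': "M' \<in> carrier_mat d d" by (simp add: M'_def)
  have "M = c x \<cdot>\<^sub>m F x + M'"
    using insert.prems carrier_matD[OF Fx] insert.hyps by (intro eq_matI) (auto simp: M'_def)
  then have "E M = c x \<cdot>\<^sub>m E (F x) + E M'"
    using E Fx M' by (simp add: linear_mat_map_def)
  moreover have "E M' $$ (s, t) = (\<Sum>k\<in>S. c k * E (F k) $$ (s, t))"
    by (rule insert.IH) (use insert.prems(1) M' in \<open>auto simp: M'_def\<close>)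
  moreover have "E (F x) \<in> carrier_mat d d" "E M' \<in> carrier_mat d d"
    using E Fx M' by (auto simp: linear_mat_map_def)
  ultimately show ?case using st insert.hyps by simp
qed

lemma mat_trace_mult_sum:
  assumes "\<And>k. k < n \<Longrightarrow> F k \<in> carrier_mat d d" and "A \<in> carrier_mat d d"
    and "\<And>s t. s < d \<Longrightarrow> t < d \<Longrightarrow> A $$ (s, t) = (\<Sum>k<n. c k * F k $$ (s, t))"
  shows "C \<in> carrier_mat d d \<Longrightarrow> mat_trace (C * A) = (\<Sum>k<n. c k * mat_trace (C * F k))"
    and "mat_trace (A * A) = (\<Sum>k<n. \<Sum>l<n. c k * c l * mat_trace (F k * F l))"
proof -
  show *: "mat_trace (C * A) = (\<Sum>k<n. c k * mat_trace (C * F k))"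
    if "C \<in> carrier_mat d d" for C
  proof -
    have "mat_trace (C * A) = (\<Sum>s<d. \<Sum>t<d. \<Sum>k<n. c k * (C $$ (s, t) * F k $$ (t, s)))"
      unfolding mat_trace_mult[OF that assms(2)]
      by (intro sum.cong refl) (simp add: assms(3) sum_distrib_left mult_ac)
    also have "\<dots> = (\<Sum>k<n. \<Sum>s<d. \<Sum>t<d. c k * (C $$ (s, t) * F k $$ (t, s)))"
      by (subst (2) sum.swap, subst sum.swap, rule refl)
    also have "\<dots> = (\<Sum>k<n. c k * mat_trace (C * F k))"
      by (simp add: mat_trace_mult[OF that assms(1)] sum_distrib_left)
    finally show ?thesis .
  qed
  have comm: "mat_trace (C * D) = mat_trace (D * C)" if "C \<in> carrier_mat d d" "D \<in> carrier_mat d d" for C D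
    unfolding mat_trace_mult[OF that] mat_trace_mult[OF that(2,1)]
    by (subst sum.swap) (simp add: mult.commute)
  have "mat_trace (A * A) = (\<Sum>l<n. c l * mat_trace (A * F l))" by (rule *[OF assms(2)])
  also have "\<dots> = (\<Sum>l<n. c l * (\<Sum>k<n. c k * mat_trace (F l * F k)))"
    by (intro sum.cong refl) (simp add: comm[OF assms(2,1)] *[OF assms(1)])
  finally show "mat_trace (A * A) = (\<Sum>k<n. \<Sum>l<n. c k * c l * mat_trace (F k * F l))"
    by (simp add: sum_distrib_left mult.assoc)
qed

section \<open>Positive maps and their Hilbert-Schmidt contraction bounds\<close>

definition positive_mat_map :: "nat \<Rightarrow> (complex mat \<Rightarrow> complex mat) \<Rightarrow> bool" where
  "positive_mat_map d E \<longleftrightarrow> linear_mat_map d E \<and> (\<forall>M. psd_mat d M \<longrightarrow> psd_mat d (E M))"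

definition hermitian_mat :: "nat \<Rightarrow> complex mat \<Rightarrow> bool" where
  "hermitian_mat d A \<longleftrightarrow> A \<in> carrier_mat d d \<and> (\<forall>s<d. \<forall>t<d. A $$ (t, s) = cnj (A $$ (s, t)))"

lemma hermitian_matD:
  assumes "hermitian_mat d A"
  shows "A \<in> carrier_mat d d" "s < d \<Longrightarrow> t < d \<Longrightarrow> A $$ (t, s) = cnj (A $$ (s, t))"
  using assms unfolding hermitian_mat_def by blast+

lemma hermitian_matE:
  assumes "hermitian_mat d H"
  obtains w l where "spectral_decomp d H w l"
  using hermitian_spectral_decomp[OF hermitian_matD[OF assms]] by blast

lemma spectral_decomp_rank_one:
  assumes "spectral_decomp d H w l" "s < d" "t < d"
  shows "H $$ (s, t) = (\<Sum>k<d. of_real (l k) * rank_one d (w k) $$ (s, t))"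
  using assms by (simp add: spectral_decompD(1)[OF assms(1)] rank_one_def)

lemma spectral_decomp_image:
  assumes "linear_mat_map d E" "H \<in> carrier_mat d d" "spectral_decomp d H w l" "s < d" "t < d"
  shows "E H $$ (s, t) = (\<Sum>k<d. of_real (l k) * E (rank_one d (w k)) $$ (s, t))"
  by (rule linear_mat_map_sum[OF assms(1) _ _ assms(2) _ assms(4,5)])
    (simp_all add: spectral_decomp_rank_one[OF assms(3)])

text \<open>A Hermitian matrix is a real combination of rank-one projectors, and their images are
  positive semidefinite, hence Hermitian.\<close>

lemma positive_mat_map_hermitian:
  assumes E: "positive_mat_map d E" and H: "hermitian_mat d H"
  shows "hermitian_mat d (E H)"
proof -
  obtain w l where wl: "spectral_decomp d H w l" using hermitian_matE[OF H] .
  have lin: "linear_mat_map d E" and Hc: "H \<in> carrier_mat d d"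
    using E hermitian_matD(1)[OF H] by (auto simp: positive_mat_map_def)
  have F: "E (rank_one d (w k)) $$ (t, s) = cnj (E (rank_one d (w k)) $$ (s, t))" if "s < d" "t < d" for s t k
    using E psd_rank_one that by (intro psd_mat_hermitian[of d]) (simp_all add: positive_mat_map_def)
  have "E H $$ (t, s) = cnj (E H $$ (s, t))" if "s < d" "t < d" for s t
    unfolding spectral_decomp_image[OF lin Hc wl that] spectral_decomp_image[OF lin Hc wl that(2,1)] cnj_sum
    by (intro sum.cong refl) (simp add: F[OF that])
  moreover have "E H \<in> carrier_mat d d" using lin Hc by (simp add: linear_mat_map_def)
  ultimately show ?thesis unfolding hermitian_mat_def by blast
qed

text \<open>Cauchy-Schwarz against the constant vector 1. It yields both the dimension factor in the
  contraction bound and \<open>p^2 \<le> u\<close>.\<close>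

lemma sum_squared_le_card_mult:
  fixes f :: "nat \<Rightarrow> real"
  shows "(\<Sum>k<n. f k)\<^sup>2 \<le> real n * (\<Sum>k<n. (f k)\<^sup>2)"
proof -
  have "\<bar>\<Sum>k<n. f k\<bar> \<le> (\<Sum>k<n. \<bar>1\<bar> * \<bar>f k\<bar>)" by (simp add: sum_abs)
  also have "\<dots> \<le> L2_set (\<lambda>k. 1) {..<n} * L2_set f {..<n}" by (rule L2_set_mult_ineq)
  also have "\<dots> = sqrt (real n * (\<Sum>k<n. (f k)\<^sup>2))" by (simp add: L2_set_def real_sqrt_mult)
  finally have "\<bar>\<Sum>k<n. f k\<bar> \<le> sqrt (real n * (\<Sum>k<n. (f k)\<^sup>2))" .
  then have "\<bar>\<Sum>k<n. f k\<bar>\<^sup>2 \<le> (sqrt (real n * (\<Sum>k<n. (f k)\<^sup>2)))\<^sup>2"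
    by (rule power_mono) simp
  then show ?thesis by (simp add: sum_nonneg)
qed

text \<open>The Gram matrix, for the Hilbert-Schmidt inner product, of the images of the
  eigenprojectors.\<close>

definition image_gram :: "nat \<Rightarrow> (complex mat \<Rightarrow> complex mat) \<Rightarrow> (nat \<Rightarrow> nat \<Rightarrow> complex) \<Rightarrow> nat \<Rightarrow> nat \<Rightarrow> real" where
  "image_gram d E w j k = Re (mat_trace (E (rank_one d (w j)) * E (rank_one d (w k))))"

text \<open>The images of the eigenprojectors are positive semidefinite with trace 1, so
  \<open>psd_trace_mult\<close> places the entries between 0 and 1. For unital \<open>E\<close> the
  images add up to the identity, and a row sum is then the trace of one image.\<close>

lemma image_gram:
  assumes E: "positive_mat_map d E" and tp: "trace_preserving d E"
    and Hc: "H \<in> carrier_mat d d" and wl: "spectral_decomp d H w l"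
  shows "0 \<le> image_gram d E w j k"
    and "j < d \<Longrightarrow> k < d \<Longrightarrow> image_gram d E w j k \<le> 1"
    and "image_gram d E w j k = image_gram d E w k j"
    and "Re (mat_trace (E H * E H)) = (\<Sum>j<d. \<Sum>k<d. l j * l k * image_gram d E w j k)"
    and "unital_map d E \<Longrightarrow> j < d \<Longrightarrow> (\<Sum>k<d. image_gram d E w j k) = 1"
proof -
  define F where "F k = E (rank_one d (w k))" for k
  note G_def = image_gram_def F_def[symmetric]
  have lin: "linear_mat_map d E" using E by (simp add: positive_mat_map_def)
  have psd: "psd_mat d (F k)" for k
    using E psd_rank_one by (simp add: positive_mat_map_def F_def)
  have F: "F k \<in> carrier_mat d d" for k using psd by (rule psd_carrier)
  have tr: "mat_trace (F k) = 1" if "k < d" for k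
    using tp that by (simp add: trace_preserving_def F_def mat_trace_rank_one spectral_decompD(2)[OF wl])
  have EH: "E H \<in> carrier_mat d d" using lin Hc by (simp add: linear_mat_map_def)
  have gram: "mat_trace (E H * E H) = (\<Sum>j<d. \<Sum>k<d. of_real (l j) * of_real (l k) * mat_trace (F j * F k))"
    by (rule mat_trace_mult_sum(2)[OF F EH]) (simp add: spectral_decomp_image[OF lin Hc wl] F_def)
  show "0 \<le> image_gram d E w j k" unfolding G_def by (rule psd_trace_mult(1)[OF psd psd])
  show "image_gram d E w j k \<le> 1" if "j < d" "k < d"
    using psd_trace_mult(2)[OF psd psd, of j k] that by (simp add: G_def tr)
  show "image_gram d E w j k = image_gram d E w k j"
    unfolding G_def mat_trace_mult[OF F F] by (subst sum.swap) (simp add: mult.commute)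
  show "Re (mat_trace (E H * E H)) = (\<Sum>j<d. \<Sum>k<d. l j * l k * image_gram d E w j k)"
    unfolding gram G_def by (simp add: mult.assoc)
  show "(\<Sum>k<d. image_gram d E w j k) = 1" if "unital_map d E" "j < d"
  proof -
    have "mat_trace (F j * 1\<^sub>m d) = (\<Sum>k<d. 1 * mat_trace (F j * F k))"
    proof (rule mat_trace_mult_sum(1)[OF F _ _ F])
      fix s t assume st: "s < d" "t < d"
      have "E (1\<^sub>m d) $$ (s, t) = (\<Sum>k<d. 1 * E (rank_one d (w k)) $$ (s, t))"
        using st by (intro linear_mat_map_sum[OF lin])
          (simp_all add: rank_one_def spectral_decompD(3)[OF wl])
      then show "(1\<^sub>m d) $$ (s, t) = (\<Sum>k<d. 1 * F k $$ (s, t))"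
        using that(1) by (simp add: unital_map_def F_def)
    qed simp
    moreover have "mat_trace (F j * 1\<^sub>m d) = 1" using tr[OF that(2)] F[of j] by simp
    ultimately have "(\<Sum>k<d. 1 * mat_trace (F j * F k)) = 1" by (rule trans[OF sym])
    from arg_cong[OF this, of Re] show ?thesis by (simp add: G_def)
  qed
qed

lemma spectral_decomp_trace:
  assumes "H \<in> carrier_mat d d" "spectral_decomp d H w l"
  shows "mat_trace H = of_real (\<Sum>k<d. l k)"
    and "mat_trace (H * H) = of_real (\<Sum>k<d. (l k)\<^sup>2)"
proof -
  note wl = assms(2)
  have "mat_trace H = (\<Sum>s<d. \<Sum>k<d. of_real (l k) * (cnj (w k s) * w k s))"
    using assms(1) by (simp add: mat_trace_def spectral_decompD(1)[OF wl] mult_ac)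
  also have "\<dots> = (\<Sum>k<d. of_real (l k) * (\<Sum>s<d. cnj (w k s) * w k s))"
    by (subst sum.swap) (simp add: sum_distrib_left)
  finally show "mat_trace H = of_real (\<Sum>k<d. l k)" by (simp add: spectral_decompD(2)[OF wl])
  have ip: "mat_trace (rank_one d (w j) * rank_one d (w k)) = (if j = k then 1 else 0)"
    if "j < d" "k < d" for j k
  proof -
    have "mat_trace (rank_one d (w j) * rank_one d (w k))
        = (\<Sum>s<d. cnj (w k s) * w j s) * (\<Sum>t<d. cnj (w j t) * w k t)"
      unfolding mat_trace_mult[OF rank_one_carrier rank_one_carrier] sum_product
      by (intro sum.cong refl) (simp add: rank_one_def mult_ac)
    then show ?thesis using that by (simp add: spectral_decompD(2)[OF wl])
  qed
  have "mat_trace (H * H) = (\<Sum>j<d. \<Sum>k<d. of_real (l j) * of_real (l k)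
      * mat_trace (rank_one d (w j) * rank_one d (w k)))"
    by (rule mat_trace_mult_sum(2)[OF _ assms(1)]) (simp_all add: spectral_decomp_rank_one[OF wl])
  also have "\<dots> = (\<Sum>j<d. \<Sum>k<d. if j = k then of_real ((l j)\<^sup>2) else 0)"
    by (intro sum.cong refl) (simp add: ip power2_eq_square)
  finally show "mat_trace (H * H) = of_real (\<Sum>k<d. (l k)\<^sup>2)" by simp
qed

text \<open>Entries with a negative product \<open>l j * l k\<close> are dropped, the others are
  bounded by \<open>G \<le> 1\<close>; half the sum of \<open>\<bar>x\<bar>\<close> and
  \<open>x\<close> is the positive part that remains. The signed half sums to zero because
  \<open>H\<close> is traceless, which is where the factor 1/2 comes from.\<close>

lemma positive_trace_preserving_contraction:
  assumes E: "positive_mat_map d E" and tp: "trace_preserving d E"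
    and H: "hermitian_mat d H" and tr: "mat_trace H = 0"
  shows "Re (mat_trace (E H * E H)) \<le> real d / 2 * Re (mat_trace (H * H))"
proof -
  obtain w l where wl: "spectral_decomp d H w l" using hermitian_matE[OF H] .
  have Hc: "H \<in> carrier_mat d d" by (rule hermitian_matD(1)[OF H])
  let ?G = "image_gram d E w"
  note G = image_gram[OF E tp Hc wl]
  have 0: "(\<Sum>k<d. l k) = 0" using spectral_decomp_trace(1)[OF Hc wl] tr by (simp del: of_real_sum)
  have le: "l j * l k * ?G j k \<le> (\<bar>l j\<bar> * \<bar>l k\<bar> + l j * l k) / 2" if "j < d" "k < d" for j k
  proof (cases "0 \<le> l j * l k")
    case True
    then show ?thesis using mult_left_mono[OF G(2)[OF that] True] by (simp flip: abs_mult)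
  next
    case False
    then have "l j * l k * ?G j k \<le> 0" using G(1) by (simp add: mult_nonpos_nonneg)
    then show ?thesis using False by (simp flip: abs_mult)
  qed
  have "(\<Sum>j<d. \<Sum>k<d. l j * l k * ?G j k) \<le> (\<Sum>j<d. \<Sum>k<d. (\<bar>l j\<bar> * \<bar>l k\<bar> + l j * l k) / 2)"
    by (intro sum_mono le) auto
  also have "\<dots> = ((\<Sum>j<d. \<bar>l j\<bar>)\<^sup>2 + (\<Sum>j<d. l j)\<^sup>2) / 2"
    by (simp only: power2_eq_square sum_product sum.distrib sum_divide_distrib[symmetric])
  also have "\<dots> \<le> real d / 2 * (\<Sum>k<d. (l k)\<^sup>2)"
    using sum_squared_le_card_mult[of "\<lambda>k. \<bar>l k\<bar>" d] 0 by simp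
  finally show ?thesis using G(4) spectral_decomp_trace(2)[OF Hc wl] by simp
qed

text \<open>The product \<open>l j * l k\<close> is at most the mean of the two squares, and every
  row and column of the symmetric matrix \<open>G\<close> sums to 1.\<close>

lemma positive_unital_contraction:
  assumes E: "positive_mat_map d E" and tp: "trace_preserving d E" and un: "unital_map d E"
    and H: "hermitian_mat d H"
  shows "Re (mat_trace (E H * E H)) \<le> Re (mat_trace (H * H))"
proof -
  obtain w l where wl: "spectral_decomp d H w l" using hermitian_matE[OF H] .
  have Hc: "H \<in> carrier_mat d d" by (rule hermitian_matD(1)[OF H])
  let ?G = "image_gram d E w"
  note G = image_gram[OF E tp Hc wl]
  have le: "l j * l k * ?G j k \<le> ((l j)\<^sup>2 * ?G j k + (l k)\<^sup>2 * ?G k j) / 2" if "j < d" "k < d" for j k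
  proof -
    have "l j * l k \<le> ((l j)\<^sup>2 + (l k)\<^sup>2) / 2" using sum_squares_bound[of "l j" "l k"] by simp
    from mult_right_mono[OF this G(1)] show ?thesis
      by (simp add: G(3)[of k j] distrib_right)
  qed
  have "(\<Sum>j<d. \<Sum>k<d. l j * l k * ?G j k) \<le> (\<Sum>j<d. \<Sum>k<d. ((l j)\<^sup>2 * ?G j k + (l k)\<^sup>2 * ?G k j) / 2)"
    by (intro sum_mono le) auto
  also have "\<dots> = ((\<Sum>j<d. \<Sum>k<d. (l j)\<^sup>2 * ?G j k) + (\<Sum>j<d. \<Sum>k<d. (l k)\<^sup>2 * ?G k j)) / 2"
    by (simp only: sum.distrib sum_divide_distrib[symmetric])
  also have "(\<Sum>j<d. \<Sum>k<d. (l k)\<^sup>2 * ?G k j) = (\<Sum>j<d. \<Sum>k<d. (l j)\<^sup>2 * ?G j k)"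
    by (rule sum.swap)
  also have "(\<Sum>j<d. \<Sum>k<d. (l j)\<^sup>2 * ?G j k) = (\<Sum>j<d. (l j)\<^sup>2)"
    by (simp add: G(5)[OF un] flip: sum_distrib_left)
  finally show ?thesis using G(4) spectral_decomp_trace(2)[OF Hc wl] by simp
qed

section \<open>Complete positivity and the Choi matrix\<close>

text \<open>The case of a one-dimensional ancilla, where the single block is the whole
  matrix.\<close>

lemma completely_positive_imp_positive:
  assumes lin: "linear_mat_map d E" and cp: "completely_positive d E"
  shows "positive_mat_map d E"
  unfolding positive_mat_map_def
proof (intro conjI allI impI lin)
  fix M assume M: "psd_mat d M"
  have Mc: "M \<in> carrier_mat d d" by (rule psd_carrier[OF M])
  have EM: "E M \<in> carrier_mat d d" using lin Mc by (simp add: linear_mat_map_def)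
  have "mat_block d M 0 0 = M"
    by (rule eq_matI) (use Mc in \<open>auto simp: mat_block_def\<close>)
  then have "id_tensor 1 d E M = E M"
    by (intro eq_matI) (use EM in \<open>auto simp: id_tensor_def\<close>)
  moreover have "psd_mat (1 * d) (id_tensor 1 d E M)"
    using cp M unfolding completely_positive_def by (metis mult_1)
  ultimately show "psd_mat d (E M)" by simp
qed

definition mat_unit :: "nat \<Rightarrow> nat \<Rightarrow> nat \<Rightarrow> complex mat" where
  "mat_unit d a b = mat d d (\<lambda>(s, t). if s = a \<and> t = b then 1 else 0)"

lemma mat_unit_carrier [simp]: "mat_unit d a b \<in> carrier_mat d d"
  by (simp add: mat_unit_def)

lemma mat_unit_diag: "mat_unit d a a = rank_one d (\<lambda>s. if s = a then 1 else 0)"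
  by (rule eq_matI) (auto simp: mat_unit_def rank_one_def)

lemma mat_trace_mult_mat_unit:
  assumes "A \<in> carrier_mat d d" "a < d" "b < d"
  shows "mat_trace (A * mat_unit d a b) = A $$ (b, a)"
proof -
  have "mat_trace (A * mat_unit d a b) = (\<Sum>s<d. \<Sum>t<d. if t = a then (if s = b then A $$ (s, t) else 0) else 0)"
    unfolding mat_trace_mult[OF assms(1) mat_unit_carrier]
    by (intro sum.cong refl) (simp add: mat_unit_def)
  then show ?thesis using assms(2,3) by simp
qed

text \<open>The indices with equal block number and inner position are exactly
  \<open>a * d + a\<close>; they support the maximally entangled vector.\<close>

lemma sum_diagonal_blocks:
  fixes g :: "nat \<Rightarrow> 'a :: comm_monoid_add"
  shows "(\<Sum>i<d * d. if i div d = i mod d then g i else 0) = (\<Sum>a<d. g (a * d + a))"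
proof -
  have "(\<Sum>i<d * d. if i div d = i mod d then g i else 0) = sum g {i. i < d * d \<and> i div d = i mod d}"
    by (simp add: sum.If_cases Int_def lessThan_def)
  also have "\<dots> = (\<Sum>a<d. g (a * d + a))"
  proof (rule sum.reindex_bij_witness[where j = "\<lambda>i. i div d" and i = "\<lambda>a. a * d + a"])
    fix i assume "i \<in> {i. i < d * d \<and> i div d = i mod d}"
    then have i: "i < d * d" "i div d = i mod d" by auto
    show "i div d * d + i div d = i" using i(2) div_mult_mod_eq[of i d] by simp
    then show "g (i div d * d + i div d) = g i" by simp
    show "i div d \<in> {..<d}" using i(1) by (simp add: less_mult_imp_div_less)
  next
    fix a assume "a \<in> {..<d}"
    then have a: "a < d" by simp
    then have "a * d + a < (a + 1) * d" by simp
    also have "\<dots> \<le> d * d" using a by (intro mult_right_mono) auto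
    finally show "a * d + a \<in> {i. i < d * d \<and> i div d = i mod d}" using a by simp
    show "(a * d + a) div d = a" using a by simp
  qed
  finally show ?thesis .
qed

text \<open>The matrix below is a principal submatrix of the Choi matrix of \<open>E\<close>; its entries add up
  to the trace of \<open>E\<close> as a linear map.\<close>

definition choi_corner :: "nat \<Rightarrow> (complex mat \<Rightarrow> complex mat) \<Rightarrow> complex mat" where
  "choi_corner d E = mat d d (\<lambda>(a, b). E (mat_unit d a b) $$ (a, b))"

text \<open>Complete positivity with an ancilla of dimension \<open>d\<close>, applied to the
  maximally entangled projector, makes the Choi matrix positive semidefinite. Test vectors supported
  on the indices \<open>a * d + a\<close> then see only the corner.\<close>

lemma psd_choi_corner:
  assumes cp: "completely_positive d E"
  shows "psd_mat d (choi_corner d E)"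
  unfolding psd_mat_iff
proof (intro conjI allI)
  fix y :: "nat \<Rightarrow> complex"
  \<comment> \<open>The unnormalised maximally entangled vector; the blocks of its rank-one matrix
    are the matrix units.\<close>
  define f :: "nat \<Rightarrow> complex" where "f i = (if i div d = i mod d then 1 else 0)" for i
  define C where "C = id_tensor d d E (rank_one (d * d) f)"
  define x where "x i = (if i div d = i mod d then y (i div d) else 0)" for i
  have lt: "a * d + s < d * d" if "a < d" "s < d" for a s
  proof -
    have "a * d + s < (a + 1) * d" using that by simp
    also have "\<dots> \<le> d * d" using that by (intro mult_right_mono) auto
    finally show ?thesis .
  qed
  have blk: "mat_block d (rank_one (d * d) f) a b = mat_unit d a b" if "a < d" "b < d" for a b
    by (rule eq_matI) (use that lt in \<open>auto simp: mat_block_def rank_one_def mat_unit_def f_def\<close>)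
  have C: "C $$ (a * d + a, b * d + b) = choi_corner d E $$ (a, b)" if "a < d" "b < d" for a b
    using that lt by (simp add: C_def id_tensor_def blk choi_corner_def)
  have "psd_mat (d * d) C"
    using cp psd_rank_one unfolding C_def completely_positive_def by blast
  then have "0 \<le> (\<Sum>i<d * d. \<Sum>j<d * d. cnj (x i) * C $$ (i, j) * x j)"
    by (rule psd_quadratic_form_nonneg)
  also have "\<dots> = (\<Sum>i<d * d. if i div d = i mod d then
      (\<Sum>j<d * d. if j div d = j mod d then cnj (y (i div d)) * C $$ (i, j) * y (j div d) else 0) else 0)"
    by (intro sum.cong refl) (auto simp: x_def intro!: sum.cong)
  also have "\<dots> = (\<Sum>a<d. \<Sum>b<d. cnj (y ((a * d + a) div d)) * C $$ (a * d + a, b * d + b) * y ((b * d + b) div d))"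
    by (simp only: sum_diagonal_blocks)
  also have "\<dots> = (\<Sum>a<d. \<Sum>b<d. cnj (y a) * choi_corner d E $$ (a, b) * y b)"
    by (intro sum.cong refl) (simp add: C)
  finally show "0 \<le> (\<Sum>a<d. \<Sum>b<d. cnj (y a) * choi_corner d E $$ (a, b) * y b)" .
qed (simp add: choi_corner_def)

text \<open>\<open>S\<close> is the trace of the corner times the all-ones matrix \<open>?J\<close>.
  Both factors are positive semidefinite with trace at most \<open>d\<close>, so
  \<open>psd_trace_mult\<close> gives both bounds.\<close>

lemma sum_choi_corner_bounds:
  assumes E: "quantum_channel d E"
  defines "S \<equiv> (\<Sum>a<d. \<Sum>b<d. E (mat_unit d a b) $$ (a, b))"
  shows "0 \<le> Re S" and "Re S \<le> (real d)\<^sup>2"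
proof -
  let ?D = "choi_corner d E" and ?J = "rank_one d (\<lambda>_. 1)"
  have lin: "linear_mat_map d E" and cp: "completely_positive d E" and tp: "trace_preserving d E"
    using E by (auto simp: quantum_channel_def)
  have pos: "positive_mat_map d E" by (rule completely_positive_imp_positive[OF lin cp])
  have D: "psd_mat d ?D" by (rule psd_choi_corner[OF cp])
  have DJ: "mat_trace (?D * ?J) = S"
    unfolding mat_trace_mult[OF psd_carrier[OF D] rank_one_carrier] S_def
    by (intro sum.cong refl) (simp add: choi_corner_def rank_one_def)
  have J: "mat_trace ?J = of_nat d" by (simp add: mat_trace_rank_one)
  \<comment> \<open>The entry is the trace of a product of two positive semidefinite matrices of
    trace 1.\<close>
  have diag: "Re (E (mat_unit d a a) $$ (a, a)) \<le> 1" if "a < d" for a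
  proof -
    have unit: "psd_mat d (mat_unit d a a)" unfolding mat_unit_diag by (rule psd_rank_one)
    then have EU: "psd_mat d (E (mat_unit d a a))" using pos by (simp add: positive_mat_map_def)
    have tr: "mat_trace (mat_unit d a a) = 1"
    proof -
      have "mat_trace (mat_unit d a a) = (\<Sum>s<d. if s = a then 1 else 0)"
        unfolding mat_trace_def by (intro sum.cong) (simp_all add: mat_unit_def)
      then show ?thesis using that by simp
    qed
    have "mat_trace (E (mat_unit d a a)) = 1" using tp tr by (simp add: trace_preserving_def)
    then show ?thesis
      using psd_trace_mult(2)[OF EU unit] tr mat_trace_mult_mat_unit[OF psd_carrier[OF EU] that that] by simp
  qed
  show "0 \<le> Re S" using psd_trace_mult(1)[OF D psd_rank_one, of "\<lambda>_. 1"] by (simp add: DJ)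
  have "Re S \<le> Re (mat_trace ?D) * real d"
    using psd_trace_mult(2)[OF D psd_rank_one, of "\<lambda>_. 1"] by (simp add: DJ J)
  also have "Re (mat_trace ?D) = (\<Sum>a<d. Re (E (mat_unit d a a) $$ (a, a)))"
    by (simp add: mat_trace_def choi_corner_def)
  also have "\<dots> * real d \<le> (\<Sum>a<d. 1) * real d"
    by (intro mult_right_mono sum_mono diag) auto
  finally show "Re S \<le> (real d)\<^sup>2" by (simp add: power2_eq_square)
qed

section \<open>The unital block\<close>

lemma hermitian_trace_mult_real:
  assumes "hermitian_mat d A" "hermitian_mat d C"
  shows "mat_trace (A * C) = of_real (Re (mat_trace (A * C)))"
proof -
  note A = hermitian_matD[OF assms(1)] and C = hermitian_matD[OF assms(2)]
  have "cnj (mat_trace (A * C)) = (\<Sum>s<d. \<Sum>t<d. A $$ (t, s) * C $$ (s, t))"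
    unfolding mat_trace_mult[OF A(1) C(1)] cnj_sum
    by (intro sum.cong refl) (simp add: A(2)[symmetric] C(2)[symmetric])
  also have "\<dots> = mat_trace (A * C)"
    unfolding mat_trace_mult[OF A(1) C(1)] by (rule sum.swap)
  finally show ?thesis by (simp add: complex_eq_iff)
qed

text \<open>For a Hermitian basis and a Hermiticity-preserving map this is the unital block itself,
  with real entries; \<open>Suc\<close> skips the multiple of the identity.\<close>

definition real_block :: "(nat \<Rightarrow> complex mat) \<Rightarrow> (complex mat \<Rightarrow> complex mat) \<Rightarrow> nat \<Rightarrow> nat \<Rightarrow> real" where
  "real_block B E j k = Re (mat_trace (B (Suc j) * E (B (Suc k))))"

section \<open>Coordinates with respect to the Hermitian basis\<close>

context
  fixes d n :: nat and B :: "nat \<Rightarrow> complex mat"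
  assumes onb: "hermitian_onb d B" and d: "d > 0" and n: "n = d\<^sup>2 - 1"
begin

lemma dim_eq: "d\<^sup>2 = Suc n"
  using d n by simp

lemma basis_adjoint: "j < Suc n \<Longrightarrow> mat_adjoint (B j) = B j"
  using onb by (simp add: hermitian_onb_def dim_eq)

lemma basis_carrier: "j < Suc n \<Longrightarrow> B j \<in> carrier_mat d d"
  using onb by (simp add: hermitian_onb_def dim_eq)

lemma basis_hermitian:
  assumes "j < Suc n"
  shows "hermitian_mat d (B j)"
proof -
  have "B j $$ (t, s) = cnj (B j $$ (s, t))" if "s < d" "t < d" for s t
    using index_mat_adjoint[OF basis_carrier[OF assms] that(2,1)] by (simp add: basis_adjoint[OF assms])
  then show ?thesis using basis_carrier[OF assms] unfolding hermitian_mat_def by blast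
qed

lemma basis_orthonormal:
  assumes "j < Suc n" "k < Suc n"
  shows "mat_trace (B j * B k) = (if j = k then 1 else 0)"
proof -
  have "mat_trace (mat_adjoint (B j) * B k) = (if j = k then 1 else 0)"
    using onb assms unfolding hermitian_onb_def dim_eq by blast
  then show ?thesis by (simp only: basis_adjoint[OF assms(1)])
qed

text \<open>Spanning provides some coefficients, and orthonormality identifies them as the traces
  against the basis elements.\<close>

lemma basis_expansion:
  assumes A: "A \<in> carrier_mat d d" and st: "s < d" "t < d"
  shows "A $$ (s, t) = (\<Sum>j<Suc n. mat_trace (B j * A) * B j $$ (s, t))"
proof -
  obtain c where c: "\<And>s t. s < d \<Longrightarrow> t < d \<Longrightarrow> A $$ (s, t) = (\<Sum>j<Suc n. c j * B j $$ (s, t))"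
    using onb A unfolding hermitian_onb_def dim_eq by metis
  have "mat_trace (B k * A) = c k" if "k < Suc n" for k
  proof -
    have "mat_trace (B k * A) = (\<Sum>j<Suc n. c j * mat_trace (B k * B j))"
      by (rule mat_trace_mult_sum(1)[OF basis_carrier A c basis_carrier[OF that]])
    also have "\<dots> = (\<Sum>j<Suc n. if k = j then c j else 0)"
      by (intro sum.cong refl) (simp add: basis_orthonormal[OF that] del: sum.lessThan_Suc)
    finally show ?thesis using that by (simp del: sum.lessThan_Suc)
  qed
  then show ?thesis using c[OF st] by (simp del: sum.lessThan_Suc)
qed

lemma trace_mult_basis_0:
  assumes "A \<in> carrier_mat d d"
  shows "mat_trace (B 0 * A) = of_real (1 / sqrt (real d)) * mat_trace A"
proof -
  have B0: "B 0 = of_real (1 / sqrt (real d)) \<cdot>\<^sub>m 1\<^sub>m d" using onb by (simp add: hermitian_onb_def)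
  have "B 0 * A = of_real (1 / sqrt (real d)) \<cdot>\<^sub>m A"
    unfolding B0 using assms by (simp add: mult_smult_assoc_mat[of _ d d _ d])
  then show ?thesis using assms by (simp add: mat_trace_def sum_distrib_left)
qed

lemma basis_traceless:
  assumes "j < n"
  shows "mat_trace (B (Suc j)) = 0"
  using trace_mult_basis_0[OF basis_carrier[of "Suc j"]] basis_orthonormal[of 0 "Suc j"] assms d by simp

lemma traceless_hermitian_expansion:
  assumes "hermitian_mat d A" "mat_trace A = 0" "s < d" "t < d"
  shows "A $$ (s, t) = (\<Sum>j<n. of_real (Re (mat_trace (B (Suc j) * A))) * B (Suc j) $$ (s, t))"
proof -
  note Ac = hermitian_matD(1)[OF assms(1)]
  have "A $$ (s, t) = (\<Sum>j<n. mat_trace (B (Suc j) * A) * B (Suc j) $$ (s, t))"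
    using basis_expansion[OF Ac assms(3,4)] trace_mult_basis_0[OF Ac] assms(2)
    by (simp add: sum.lessThan_Suc_shift del: sum.lessThan_Suc)
  also have "\<dots> = (\<Sum>j<n. of_real (Re (mat_trace (B (Suc j) * A))) * B (Suc j) $$ (s, t))"
    by (intro sum.cong refl arg_cong2[where f = "(*)"] hermitian_trace_mult_real[OF basis_hermitian assms(1)])
      simp
  finally show ?thesis .
qed

lemma image_basis_expansion:
  assumes E: "positive_mat_map d E" and tp: "trace_preserving d E" and k: "k < n" and st: "s < d" "t < d"
  shows "E (B (Suc k)) $$ (s, t) = (\<Sum>l<n. of_real (real_block B E l k) * B (Suc l) $$ (s, t))"
  unfolding real_block_def
proof (rule traceless_hermitian_expansion[OF _ _ st])
  have Bk: "hermitian_mat d (B (Suc k))" using k by (intro basis_hermitian) simp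
  then show "hermitian_mat d (E (B (Suc k)))" by (rule positive_mat_map_hermitian[OF E])
  show "mat_trace (E (B (Suc k))) = 0"
    using tp hermitian_matD(1)[OF Bk] basis_traceless[OF k] by (simp add: trace_preserving_def)
qed

text \<open>Trace preservation keeps \<open>F (B (Suc k))\<close> free of a \<open>B 0\<close>
  component, so the unital blocks multiply by themselves and the nonunital columns do not
  interfere.\<close>

lemma real_block_comp:
  assumes E: "linear_mat_map d E" and F: "positive_mat_map d F" "trace_preserving d F"
    and jk: "j < n" "k < n"
  shows "real_block B (E \<circ> F) j k = (\<Sum>l<n. real_block B E j l * real_block B F l k)"
proof -
  have Bc: "B (Suc l) \<in> carrier_mat d d" if "l < n" for l using that by (intro basis_carrier) simp
  have FB: "F (B (Suc k)) \<in> carrier_mat d d"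
    using F(1) Bc[OF jk(2)] by (simp add: positive_mat_map_def linear_mat_map_def)
  have EB: "E (B (Suc l)) \<in> carrier_mat d d" if "l < n" for l
    using E Bc[OF that] by (simp add: linear_mat_map_def)
  have EFB: "E (F (B (Suc k))) \<in> carrier_mat d d" using E FB by (simp add: linear_mat_map_def)
  have EF: "E (F (B (Suc k))) $$ (s, t) = (\<Sum>l<n. of_real (real_block B F l k) * E (B (Suc l)) $$ (s, t))"
    if "s < d" "t < d" for s t
    by (rule linear_mat_map_sum[OF E _ _ FB _ that])
      (simp_all add: Bc image_basis_expansion[OF F jk(2)])
  have "mat_trace (B (Suc j) * E (F (B (Suc k))))
      = (\<Sum>l<n. of_real (real_block B F l k) * mat_trace (B (Suc j) * E (B (Suc l))))"
    by (rule mat_trace_mult_sum(1)[OF EB EFB EF Bc[OF jk(1)]])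
  then show ?thesis by (simp add: real_block_def mult.commute)
qed

text \<open>Real vectors \<open>v\<close> correspond isometrically to traceless Hermitian matrices
  \<open>H\<close>, so the Hilbert-Schmidt bound becomes a bound on the block. Here \<open>c\<close>
  bounds the squared norm.\<close>

lemma real_block_contraction:
  assumes E: "positive_mat_map d E" and tp: "trace_preserving d E"
    and contr: "\<And>H. hermitian_mat d H \<Longrightarrow> mat_trace H = 0 \<Longrightarrow>
      Re (mat_trace (E H * E H)) \<le> c * Re (mat_trace (H * H))"
  shows "(\<Sum>i<n. (\<Sum>j<n. real_block B E i j * v j)\<^sup>2) \<le> c * (\<Sum>i<n. (v i)\<^sup>2)"
proof -
  have lin: "linear_mat_map d E" using E by (simp add: positive_mat_map_def)
  have Bc: "B (Suc l) \<in> carrier_mat d d" if "l < n" for l using that by (intro basis_carrier) simp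
  have norm: "Re (mat_trace (A * A)) = (\<Sum>i<n. (x i)\<^sup>2)"
    if "A \<in> carrier_mat d d"
      "\<And>s t. s < d \<Longrightarrow> t < d \<Longrightarrow> A $$ (s, t) = (\<Sum>j<n. of_real (x j) * B (Suc j) $$ (s, t))" for A x
  proof -
    have "mat_trace (A * A) = (\<Sum>j<n. \<Sum>k<n. of_real (x j) * of_real (x k) * mat_trace (B (Suc j) * B (Suc k)))"
      by (rule mat_trace_mult_sum(2)[OF Bc that])
    also have "\<dots> = (\<Sum>j<n. \<Sum>k<n. if j = k then of_real ((x j)\<^sup>2) else 0)"
      by (intro sum.cong refl) (simp add: basis_orthonormal power2_eq_square)
    also have "\<dots> = of_real (\<Sum>j<n. (x j)\<^sup>2)" by simp
    finally show ?thesis by simp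
  qed
  define H where "H = mat d d (\<lambda>(s, t). \<Sum>j<n. of_real (v j) * B (Suc j) $$ (s, t))"
  have Hc: "H \<in> carrier_mat d d" by (simp add: H_def)
  have Hst: "H $$ (s, t) = (\<Sum>j<n. of_real (v j) * B (Suc j) $$ (s, t))" if "s < d" "t < d" for s t
    using that by (simp add: H_def)
  have "H $$ (t, s) = cnj (H $$ (s, t))" if "s < d" "t < d" for s t
    unfolding Hst[OF that] Hst[OF that(2,1)] cnj_sum
    by (intro sum.cong refl) (simp add: hermitian_matD(2)[OF basis_hermitian that, symmetric])
  then have H: "hermitian_mat d H" using Hc unfolding hermitian_mat_def by blast
  have "mat_trace H = (\<Sum>j<n. of_real (v j) * mat_trace (B (Suc j)))"
  proof -
    have "mat_trace H = (\<Sum>s<d. \<Sum>j<n. of_real (v j) * B (Suc j) $$ (s, s))"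
      using Hc by (simp add: mat_trace_def Hst)
    also have "\<dots> = (\<Sum>j<n. of_real (v j) * (\<Sum>s<d. B (Suc j) $$ (s, s)))"
      by (subst sum.swap) (simp add: sum_distrib_left)
    also have "\<dots> = (\<Sum>j<n. of_real (v j) * mat_trace (B (Suc j)))"
      using Bc by (intro sum.cong refl) (simp add: mat_trace_def carrier_matD(1)[OF Bc])
    finally show ?thesis .
  qed
  then have tr: "mat_trace H = 0" by (simp add: basis_traceless)
  have EH: "E H \<in> carrier_mat d d" using lin Hc by (simp add: linear_mat_map_def)
  have EHst: "E H $$ (s, t) = (\<Sum>i<n. of_real (\<Sum>j<n. real_block B E i j * v j) * B (Suc i) $$ (s, t))"
    if "s < d" "t < d" for s t
  proof -
    have "E H $$ (s, t) = (\<Sum>j<n. of_real (v j) * E (B (Suc j)) $$ (s, t))"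
      by (rule linear_mat_map_sum[OF lin _ _ Hc _ that]) (simp_all add: Bc Hst)
    also have "\<dots> = (\<Sum>j<n. \<Sum>i<n. of_real (real_block B E i j * v j) * B (Suc i) $$ (s, t))"
      by (intro sum.cong refl) (simp add: image_basis_expansion[OF E tp _ that] sum_distrib_left mult_ac)
    also have "\<dots> = (\<Sum>i<n. \<Sum>j<n. of_real (real_block B E i j * v j) * B (Suc i) $$ (s, t))"
      by (rule sum.swap)
    finally show ?thesis by (simp add: sum_distrib_right)
  qed
  show ?thesis using contr[OF H tr] norm[OF Hc Hst] norm[OF EH EHst] by simp
qed

lemma depol_const_eq:
  "depol_const d B E = (\<Sum>j<n. real_block B E j j) / real n"
  by (simp add: depol_const_def mat_trace_def unital_block_def liouville_def real_block_def
      basis_adjoint dim_eq)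

text \<open>A real part is at most the modulus in absolute value, so the comparison goes entry by
  entry.\<close>

lemma frobenius_le_unitarity:
  assumes "n > 0"
  shows "(\<Sum>i<n. \<Sum>j<n. (real_block B E i j)\<^sup>2) \<le> real n * unitarity d B E"
proof -
  define U where "U = unital_block d B E"
  have U: "U \<in> carrier_mat n n" by (simp add: U_def unital_block_def n)
  have "mat_trace (mat_adjoint U * U) = (\<Sum>j<n. \<Sum>i<n. of_real ((cmod (U $$ (i, j)))\<^sup>2))"
    unfolding mat_trace_mult[OF mat_adjoint_carrier[OF U] U] complex_norm_square
    by (intro sum.cong refl) (simp add: index_mat_adjoint[OF U] mult.commute)
  also have "\<dots> = (\<Sum>i<n. \<Sum>j<n. of_real ((cmod (U $$ (i, j)))\<^sup>2))" by (rule sum.swap)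
  finally have "Re (mat_trace (mat_adjoint U * U)) = (\<Sum>i<n. \<Sum>j<n. (cmod (U $$ (i, j)))\<^sup>2)" by simp
  moreover have "(real_block B E i j)\<^sup>2 \<le> (cmod (U $$ (i, j)))\<^sup>2" if "i < n" "j < n" for i j
    using that by (simp add: cmod_power2 U_def unital_block_def liouville_def real_block_def
      basis_adjoint dim_eq)
  then have "(\<Sum>i<n. \<Sum>j<n. (real_block B E i j)\<^sup>2) \<le> (\<Sum>i<n. \<Sum>j<n. (cmod (U $$ (i, j)))\<^sup>2)"
    by (intro sum_mono) auto
  ultimately show ?thesis using assms by (simp add: unitarity_def U_def dim_eq)
qed

text \<open>Both sides are the trace of \<open>E\<close> as a linear map, computed in the matrix
  units and in the basis \<open>B\<close>.\<close>

lemma sum_mat_unit_eq: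
  assumes E: "linear_mat_map d E"
  shows "(\<Sum>a<d. \<Sum>b<d. E (mat_unit d a b) $$ (a, b)) = (\<Sum>j<Suc n. mat_trace (B j * E (B j)))"
proof -
  have EB: "E (B j) \<in> carrier_mat d d" if "j < Suc n" for j
    using E basis_carrier[OF that] by (simp add: linear_mat_map_def)
  have "E (mat_unit d a b) $$ (a, b) = (\<Sum>j<Suc n. B j $$ (b, a) * E (B j) $$ (a, b))"
    if "a < d" "b < d" for a b
    by (rule linear_mat_map_sum[OF E _ basis_carrier mat_unit_carrier _ that])
      (simp_all add: basis_expansion[OF mat_unit_carrier] mat_trace_mult_mat_unit[OF basis_carrier] that
        del: sum.lessThan_Suc)
  then have "(\<Sum>a<d. \<Sum>b<d. E (mat_unit d a b) $$ (a, b))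
      = (\<Sum>a<d. \<Sum>b<d. \<Sum>j<Suc n. B j $$ (b, a) * E (B j) $$ (a, b))"
    by (simp del: sum.lessThan_Suc)
  also have "\<dots> = (\<Sum>j<Suc n. \<Sum>a<d. \<Sum>b<d. B j $$ (b, a) * E (B j) $$ (a, b))"
    by (subst (2) sum.swap, subst sum.swap, rule refl)
  also have "\<dots> = (\<Sum>j<Suc n. mat_trace (B j * E (B j)))"
  proof (intro sum.cong refl)
    fix j assume "j \<in> {..<Suc n}"
    then have j: "j < Suc n" by simp
    show "(\<Sum>a<d. \<Sum>b<d. B j $$ (b, a) * E (B j) $$ (a, b)) = mat_trace (B j * E (B j))"
      unfolding mat_trace_mult[OF basis_carrier[OF j] EB[OF j]] by (rule sum.swap)
  qed
  finally show ?thesis .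
qed

text \<open>As a linear map, \<open>E\<close> has trace \<open>1 + n * p\<close>, the 1 coming from
  \<open>B 0\<close>, and this trace lies between 0 and \<open>d^2 = n + 1\<close>.\<close>

lemma abs_depol_const_le_1:
  assumes E: "quantum_channel d E" and n0: "n > 0"
  shows "\<bar>depol_const d B E\<bar> \<le> 1"
proof -
  have lin: "linear_mat_map d E" and tp: "trace_preserving d E"
    using E by (auto simp: quantum_channel_def)
  have B0: "B 0 \<in> carrier_mat d d" by (rule basis_carrier) simp
  have EB0: "E (B 0) \<in> carrier_mat d d" using lin B0 by (simp add: linear_mat_map_def)
  have "mat_trace (B 0 * E (B 0)) = mat_trace (B 0 * B 0)"
    using tp B0 by (simp add: trace_mult_basis_0[OF B0] trace_mult_basis_0[OF EB0] trace_preserving_def)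
  then have "mat_trace (B 0 * E (B 0)) = 1" by (simp add: basis_orthonormal)
  then have "Re (\<Sum>j<Suc n. mat_trace (B j * E (B j))) = 1 + real n * depol_const d B E"
    using n0 by (simp add: depol_const_eq sum.lessThan_Suc_shift real_block_def del: sum.lessThan_Suc)
  moreover have "(real d)\<^sup>2 = 1 + real n"
    using dim_eq by (metis of_nat_Suc of_nat_power)
  ultimately have "0 \<le> 1 + real n * depol_const d B E" "real n * depol_const d B E \<le> real n"
    using sum_choi_corner_bounds[OF E] by (simp_all add: sum_mat_unit_eq[OF lin] del: sum.lessThan_Suc)
  \<comment> \<open>The lower bound \<open>-1\<close> on \<open>n * p\<close> is weakened to
    \<open>-n\<close>, as \<open>n\<close> is at least 1.\<close>
  moreover from this(1) have "real n * (- 1) \<le> real n * depol_const d B E" using n0 by simp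
  ultimately have "depol_const d B E \<le> 1" "- 1 \<le> depol_const d B E"
    using n0 by (simp_all only: mult_le_cancel_left_pos of_nat_0_less_iff) (auto simp: mult_le_cancel_left1)
  then show ?thesis by simp
qed

end

section \<open>Composites of channels and the final estimate\<close>

lemma composite_0: "composite X 0 = id"
  by (simp add: composite_def)

text \<open>The fold is opened at its innermost map because the trace recursion extends prefixes on
  the right.\<close>

lemma composite_Suc: "composite X (Suc k) = composite X k \<circ> X (Suc k)"
proof -
  have *: "foldr (\<circ>) fs g = foldr (\<circ>) fs id \<circ> g" for fs :: "('a \<Rightarrow> 'a) list" and g
    by (induction fs) (auto simp: o_assoc)
  have "map X [1..<Suc (Suc k)] = map X [1..<Suc k] @ [X (Suc k)]" by simp
  then show ?thesis using *[of "map X [1..<Suc k]" "X (Suc k)"] unfolding composite_def by simp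
qed

lemma composite_positive:
  assumes "\<And>i. i \<in> {1..k} \<Longrightarrow> positive_mat_map d (X i) \<and> trace_preserving d (X i)"
  shows "positive_mat_map d (composite X k) \<and> trace_preserving d (composite X k)"
  using assms
proof (induction k)
  case 0
  then show ?case
    by (simp add: composite_0 positive_mat_map_def linear_mat_map_def trace_preserving_def)
next
  case (Suc k)
  then have "positive_mat_map d (composite X k) \<and> trace_preserving d (composite X k)"
    and "positive_mat_map d (X (Suc k)) \<and> trace_preserving d (X (Suc k))" by auto
  then show ?case
    by (simp add: composite_Suc positive_mat_map_def linear_mat_map_def trace_preserving_def)
qed

lemma composite_unital:
  assumes "\<And>i. i \<in> {1..k} \<Longrightarrow> unital_map d (X i)"
  shows "unital_map d (composite X k)"
  using assms by (induction k) (auto simp: composite_0 composite_Suc unital_map_def)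

text \<open>The condition \<open>p^2 \<le> u\<close> puts the argument of \<open>arccos\<close> into
  the interval on which \<open>cos\<close> inverts it.\<close>

lemma sin_coherence_angle:
  assumes "u > 0" "p\<^sup>2 \<le> u"
  shows "u * (sin (arccos (p / sqrt u)))\<^sup>2 = u - p\<^sup>2"
proof -
  have "\<bar>p\<bar> \<le> sqrt u" using assms(2) by (simp add: real_le_rsqrt)
  then have "\<bar>p / sqrt u\<bar> \<le> 1" using assms(1) by (simp add: abs_divide)
  then have "cos (arccos (p / sqrt u)) = p / sqrt u" by (rule cos_arccos_abs)
  then have "(sin (arccos (p / sqrt u)))\<^sup>2 = 1 - p\<^sup>2 / u"
    using assms(1) by (simp add: sin_squared_eq power_divide)
  then show ?thesis using assms(1) by (simp add: field_simps)
qed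

text \<open>The common form of both bounds, with the norm bound \<open>c\<close> on the prefixes
  left as a parameter.\<close>

lemma depol_const_composite_deviation:
  fixes X :: "nat \<Rightarrow> complex mat \<Rightarrow> complex mat"
  assumes d: "d \<ge> 2" and onb: "hermitian_onb d B" and "m \<ge> 1"
    and ch: "\<And>i. i \<in> {1..m} \<Longrightarrow> quantum_channel d (X i)"
    and p: "\<And>i. i \<in> {1..m} \<Longrightarrow> depol_const d B (X i) = p"
    and u: "\<And>i. i \<in> {1..m} \<Longrightarrow> unitarity d B (X i) = u"
    and "u > 0"
    and \<theta>: "\<And>i. i \<in> {1..m} \<Longrightarrow> coherence_angle d B (X i) = \<theta>"
    and c: "0 \<le> c"
    and contr: "\<And>k H. k < m \<Longrightarrow> hermitian_mat d H \<Longrightarrow> mat_trace H = 0 \<Longrightarrow>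
      Re (mat_trace (composite X k H * composite X k H)) \<le> c\<^sup>2 * Re (mat_trace (H * H))"
  shows "\<bar>depol_const d B (composite X m) - p ^ m\<bar> \<le> c * real (m choose 2) * u * (sin \<theta>)\<^sup>2"
proof -
  define n where "n = d\<^sup>2 - 1"
  have "2\<^sup>2 \<le> d\<^sup>2" using d by (rule power_mono) simp
  then have n: "n > 0" by (simp add: n_def)
  have d0: "d > 0" using d by simp
  let ?r = "real_block B" and ?P = "composite X"
  have pos: "positive_mat_map d (X i) \<and> trace_preserving d (X i)" if "i \<in> {1..m}" for i
    using ch[OF that] completely_positive_imp_positive by (auto simp: quantum_channel_def)
  have P: "positive_mat_map d (?P k)" "trace_preserving d (?P k)" if "k \<le> m" for k
    using composite_positive[of k d X] pos that by auto
  have tr: "(\<Sum>j<n. ?r (X (Suc k)) j j) = real n * p" if "k < m" for k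
    using p[of "Suc k"] that n by (simp add: depol_const_eq[OF onb d0 n_def] field_simps)
  have frob: "(\<Sum>i<n. \<Sum>j<n. (?r (X (Suc k)) i j)\<^sup>2) \<le> real n * u" if "k < m" for k
    using frobenius_le_unitarity[OF onb d0 n_def n, of "X (Suc k)"] u[of "Suc k"] that by simp
  have p1: "\<bar>p\<bar> \<le> 1"
    using abs_depol_const_le_1[OF onb d0 n_def ch n, of 1] p[of 1] \<open>m \<ge> 1\<close> by simp
  \<comment> \<open>Cauchy-Schwarz on the diagonal of one block, whose squares are then bounded by
    the full Frobenius norm.\<close>
  have "p\<^sup>2 \<le> u"
  proof -
    have m: "0 < m" using \<open>m \<ge> 1\<close> by simp
    have "(real n * p)\<^sup>2 \<le> real n * (\<Sum>j<n. (?r (X 1) j j)\<^sup>2)"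
      using sum_squared_le_card_mult[of "\<lambda>j. ?r (X 1) j j" n] tr[OF m] by simp
    also have "\<dots> \<le> real n * (\<Sum>i<n. \<Sum>j<n. (?r (X 1) i j)\<^sup>2)"
      by (intro mult_left_mono sum_mono member_le_sum) auto
    also have "\<dots> \<le> real n * (real n * u)" using frob[OF m] by (intro mult_left_mono) auto
    finally show ?thesis using n by (simp add: power2_eq_square)
  qed
  then have sin: "u * (sin \<theta>)\<^sup>2 = u - p\<^sup>2"
    using \<theta>[of 1] p[of 1] u[of 1] \<open>m \<ge> 1\<close> sin_coherence_angle[OF \<open>u > 0\<close>, of p]
    by (simp add: coherence_angle_def)
  have "\<bar>(\<Sum>i<n. ?r (?P m) i i) - real n * p ^ m\<bar> \<le> c * real (m choose 2) * (real n * (u - p\<^sup>2))"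
  \<comment> \<open>The channels are numbered from 1 and the factors \<open>M\<close> from 0, hence
    the shift.\<close>
  proof (rule trace_product_deviation[where P = "\<lambda>k. ?r (?P k)" and M = "\<lambda>k. ?r (X (Suc k))"])
    fix i j assume "i < n" "j < n"
    then show "?r (?P 0) i j = (if i = j then 1 else 0)"
      by (simp add: composite_0 real_block_def basis_orthonormal[OF onb d0 n_def])
  next
    fix k i j assume k: "k < m" and ij: "i < n" "j < n"
    have "linear_mat_map d (?P k)" using P(1)[of k] k by (simp add: positive_mat_map_def)
    then show "?r (?P (Suc k)) i j = (\<Sum>l<n. ?r (?P k) i l * ?r (X (Suc k)) l j)"
      unfolding composite_Suc using real_block_comp[OF onb d0 n_def _ _ _ ij] pos[of "Suc k"] k by simp
  next
    fix k and v :: "nat \<Rightarrow> real" assume k: "k < m"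
    show "(\<Sum>i<n. (\<Sum>j<n. ?r (?P k) i j * v j)\<^sup>2) \<le> c\<^sup>2 * (\<Sum>i<n. (v i)\<^sup>2)"
      using P[of k] k by (intro real_block_contraction[OF onb d0 n_def] contr) auto
  qed (fact c p1 tr frob)+
  moreover have "depol_const d B (?P m) - p ^ m = ((\<Sum>i<n. ?r (?P m) i i) - real n * p ^ m) / real n"
    using n by (simp add: depol_const_eq[OF onb d0 n_def] diff_divide_distrib)
  ultimately have "\<bar>depol_const d B (?P m) - p ^ m\<bar> \<le> c * real (m choose 2) * (u - p\<^sup>2)"
    using n by (simp add: divide_le_eq mult_ac)
  then show ?thesis by (simp add: sin[symmetric] mult.assoc)
qed

theorem theorem4:
  fixes d m :: nat
    and B :: "nat \<Rightarrow> complex mat"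
    and X :: "nat \<Rightarrow> complex mat \<Rightarrow> complex mat"
    and p u \<theta> :: real
  assumes "d \<ge> 2" and "m \<ge> 1"
    and "hermitian_onb d B"
    and "\<And>i. i \<in> {1..m} \<Longrightarrow> quantum_channel d (X i)"
    and "\<And>i. i \<in> {1..m} \<Longrightarrow> depol_const d B (X i) = p"
    and "\<And>i. i \<in> {1..m} \<Longrightarrow> unitarity d B (X i) = u"
    and "u > 0"
    and "\<And>i. i \<in> {1..m} \<Longrightarrow> coherence_angle d B (X i) = \<theta>"
  shows "\<bar>depol_const d B (composite X m) - p ^ m\<bar>
           \<le> sqrt (real d / 2) * real (m choose 2) * u * (sin \<theta>)\<^sup>2 \<and>
         ((\<forall>i \<in> {1..m}. unital_map d (X i)) \<longrightarrow>
            \<bar>depol_const d B (composite X m) - p ^ m\<bar>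
              \<le> real (m choose 2) * u * (sin \<theta>)\<^sup>2)"
proof -
  have "positive_mat_map d (X i) \<and> trace_preserving d (X i)" if "i \<in> {1..m}" for i
    using assms(4)[OF that] completely_positive_imp_positive by (auto simp: quantum_channel_def)
  then have P: "positive_mat_map d (composite X k)" "trace_preserving d (composite X k)" if "k < m" for k
    using composite_positive[of k d X] that by auto
  note deviation = depol_const_composite_deviation[OF assms(1,3,2,4-8)]
  \<comment> \<open>Here \<open>c = sqrt (d / 2)\<close>: each prefix is itself positive and trace
    preserving, so its squared norm on traceless Hermitian matrices is at most \<open>d / 2\<close>,
    whatever its length.\<close>
  have "\<bar>depol_const d B (composite X m) - p ^ m\<bar>
      \<le> sqrt (real d / 2) * real (m choose 2) * u * (sin \<theta>)\<^sup>2"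
    by (rule deviation) (simp_all add: positive_trace_preserving_contraction[OF P, simplified])
  \<comment> \<open>Here \<open>c = 1\<close>, since prefixes of unital channels are unital; the
    factor 1 is written out to match the general bound.\<close>
  moreover have "\<bar>depol_const d B (composite X m) - p ^ m\<bar> \<le> 1 * real (m choose 2) * u * (sin \<theta>)\<^sup>2"
    if un: "\<forall>i \<in> {1..m}. unital_map d (X i)"
  proof (rule deviation)
    fix k H assume "k < m" "hermitian_mat d H"
    moreover have "unital_map d (composite X k)"
      using un \<open>k < m\<close> by (intro composite_unital) auto
    ultimately show "Re (mat_trace (composite X k H * composite X k H)) \<le> 1\<^sup>2 * Re (mat_trace (H * H))"
      using positive_unital_contraction[OF P] by simp
  qed simp_all
  ultimately show ?thesis by simp
qed

end
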